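(* Let $\mathcal{N}$ be an infinite set of positive integers. Fix a positive integer $q$, positive integers $l_1<\cdots<l_q$, and probability measures $\mu_1,\ldots,\mu_q$ on the set $\mathbb{N}$ of nonnegative integers. For each $n\in\mathcal{N}$, let $\mathbb{P}_n$ be a probability measure on $\mathfrak{S}_n$ which is invariant under conjugation. Suppose that for all $p\geq 1$, for all $k=(k_1,\ldots,k_q)\in\mathbb{N}^q$ such that $k_1l_1+\cdots+k_ql_q=p$, and for all $\sigma\in\mathfrak{S}_p$ which has $k_1$ cycles of length $l_1$, \ldots, $k_q$ cycles of length $l_q$, the sequence $$\frac{n^{p}}{l_1^{k_1}\cdots l_q^{k_q}\,k_1!\cdots k_q!}\,\mathbb{P}_n\big(\{\tau\in\mathfrak{S}_n : \forall i=1,\ldots,p,\ \tau(i)=\sigma(i)\}\big)$$ converges, as $n\in\mathcal{N}$ tends to infinity, to a limit denoted by $S_k=S_{(k_1,\ldots,k_q)}$. Set also $S_{(0,\ldots,0)}=1$. Suppose that for all integers $r_1,\ldots,r_q\geq 0$, $$\sum_{k_1\geq r_1}\cdots\sum_{k_q\geq r_q}(-1)^{k_1-r_1+\cdots+k_q-r_q}\binom{k_1}{r_1}\cdots\binom{k_q}{r_q}S_{(k_1,\ldots,k_q)}=\prod_{i=1}^{q}\mu_i(\{r_i\}),$$ where the series is not required to converge absolutely: the equality means that the partial sums $$\sum_{\substack{k_1\geq r_1,\ldots,k_q\geq r_q\\ k_1-r_1+\cdots+k_q-r_q\leq m}}(-1)^{k_1-r_1+\cdots+k_q-r_q}\binom{k_1}{r_1}\cdots\binom{k_q}{r_q}S_{(k_1,\ldots,k_q)}$$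 tend to the right-hand side as $m\to\infty$. Then, if for each $n\in\mathcal{N}$, $\sigma_n$ is a random variable with distribution $\mathbb{P}_n$, the law of $(N_{l_1}(\sigma_n),\ldots,N_{l_q}(\sigma_n))$ converges weakly, as $n\in\mathcal{N}$ tends to infinity, to $\mu_1\otimes\cdots\otimes\mu_q$.
   Context: $\mathbb{N}$ is the set of nonnegative integers, and $\mathfrak{S}_n$ is the group of permutations of $\{1,\ldots,n\}$. A probability measure $\mathbb{P}$ on $\mathfrak{S}_n$ is invariant under conjugation if $\mathbb{P}(\{\sigma\circ\tau\circ\sigma^{-1}\})=\mathbb{P}(\{\tau\})$ for all $\sigma,\tau\in\mathfrak{S}_n$. For $\sigma\in\mathfrak{S}_n$ and $l$ a positive integer, $N_l(\sigma)$ is the number of cycles of length $l$ in the decomposition of $\sigma$ as a product of cycles with disjoint supports (fixed points count as cycles of length $1$). In the hypothesis, for given $p$ the sequence is considered for $n\in\mathcal{N}$ with $n\geq p$. By invariance under conjugation, the limit does not depend on the choice of $\sigma$ with the given cycle counts. *)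

theory Defs
  imports "HOL-Probability.Probability" "HOL-Combinatorics.Orbits"
begin

text \<open>A permutation of \<open>{1..n}\<close> is a function that \<open>permutes {1..n}\<close>, so it fixes every number
  outside \<open>{1..n}\<close>.\<close>

abbreviation Sym :: "nat \<Rightarrow> (nat \<Rightarrow> nat) set" where
  "Sym n \<equiv> {\<sigma>. \<sigma> permutes {1..n}}"

definition conj_invariant :: "nat \<Rightarrow> (nat \<Rightarrow> nat) measure \<Rightarrow> bool" where
  "conj_invariant n P \<longleftrightarrow>
     (\<forall>\<sigma>\<in>Sym n. \<forall>\<tau>\<in>Sym n. measure P {\<sigma> \<circ> \<tau> \<circ> inv \<sigma>} = measure P {\<tau>})"

text \<open>A cycle of \<open>\<sigma> \<in> Sym n\<close> is identified with its support, a subset of \<open>{1..n}\<close> on which \<open>\<sigma>\<close> acts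
  cyclically; fixed points are singletons. The parameter \<open>n\<close> cannot be dropped: the numbers
  outside \<open>{1..n}\<close> would be counted as fixed points.\<close>

definition num_cycles :: "nat \<Rightarrow> nat \<Rightarrow> (nat \<Rightarrow> nat) \<Rightarrow> nat" where
  "num_cycles n l \<sigma> = card {C. C \<subseteq> {1..n} \<and> cyclic_on \<sigma> C \<and> card C = l}"

text \<open>The set \<open>\<nat>\<^sup>q\<close>: since its elements are extensional functions, each vector has exactly one
  representative.\<close>

abbreviation nat_vecs :: "nat \<Rightarrow> (nat \<Rightarrow> nat) set" where
  "nat_vecs q \<equiv> {1..q} \<rightarrow>\<^sub>E UNIV"

text \<open>The filter of \<open>n \<in> A\<close> tending to infinity.\<close>

definition at_top_in :: "nat set \<Rightarrow> nat filter" where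
  "at_top_in A = inf at_top (principal A)"

text \<open>The library only has weak convergence for sequences of measures on the real line. The
  measures below are meant to be Borel measures on the space \<open>T\<close>.\<close>

definition weakly_converges ::
    "'a topology \<Rightarrow> ('i \<Rightarrow> 'a measure) \<Rightarrow> 'a measure \<Rightarrow> 'i filter \<Rightarrow> bool" where
  "weakly_converges T M L F \<longleftrightarrow>
     (\<forall>f. continuous_map T euclideanreal f \<and> bounded (f ` topspace T) \<longrightarrow>
        ((\<lambda>n. \<integral>x. f x \<partial>M n) \<longlongrightarrow> (\<integral>x. f x \<partial>L)) F)"

end

(* Let sigma have k_i cycles of length l_i. The product of the l_i^{k_i} k_i! binom(N_{l_i}(tau), k_i)
   counts the injections phi of {1..p} into {1..n} with tau o phi = phi o sigma: phi sends the cycles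
   of sigma to distinct cycles of tau of the same lengths, with l_i choices of a starting point per
   cycle. Each phi extends to a permutation of {1..n}, so by conjugation invariance every phi
   contributes the same probability P_n(tau = sigma on {1..p}); hence the hypothesis says that the
   joint binomial moments of (N_{l_1}, ..., N_{l_q}) converge to S_k. The partial sums of the series
   over |k - r| <= m are, before passing to the limit, Bonferroni bounds for P(N = r), upper for even
   m and lower for odd m, so the point probabilities converge. On a countable discrete space,
   pointwise convergence to a probability measure is weak convergence. *)

theory Submission
  imports Defs
begin

section \<open>Equivariant injections\<close>

text \<open>Cycles are counted through their points, because it is points that an injection
  transports.\<close>

definition points_of_period :: "nat \<Rightarrow> nat \<Rightarrow> (nat \<Rightarrow> nat) \<Rightarrow> nat set" where
  "points_of_period n L \<tau> = {x\<in>{1..n}. card (orbit \<tau> x) = L}"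

text \<open>The last condition is \<open>\<tau> \<circ> \<phi> = \<phi> \<circ> \<sigma>\<close> on
  \<open>{1..p}\<close>. Extensionality fixes the values outside \<open>{1..p}\<close>, so each
  injection is counted exactly once.\<close>

definition equivariant_injections ::
    "nat \<Rightarrow> (nat \<Rightarrow> nat) \<Rightarrow> nat \<Rightarrow> (nat \<Rightarrow> nat) \<Rightarrow> (nat \<Rightarrow> nat) set" where
  "equivariant_injections p \<sigma> n \<tau> =
     {\<phi>\<in>{1..p} \<rightarrow>\<^sub>E {1..n}. inj_on \<phi> {1..p} \<and> (\<forall>x\<in>{1..p}. \<tau> (\<phi> x) = \<phi> (\<sigma> x))}"

text \<open>The added cycle runs through \<open>Suc p\<close>, ..., \<open>p + L\<close> and back to
  \<open>Suc p\<close>. Repeating this step builds any cycle type from the empty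
  permutation.\<close>

definition append_cycle :: "nat \<Rightarrow> nat \<Rightarrow> (nat \<Rightarrow> nat) \<Rightarrow> nat \<Rightarrow> nat" where
  "append_cycle p L \<sigma> x =
     (if x \<le> p then \<sigma> x else if x < p + L then Suc x else if x = p + L then Suc p else x)"

lemma Sym_permutation: "\<sigma> \<in> Sym n \<Longrightarrow> permutation \<sigma>"
  by (auto simp: permutation_permutes)

lemma Sym_self_in_orbit: "\<sigma> \<in> Sym n \<Longrightarrow> x \<in> orbit \<sigma> x"
  by (intro permutation_self_in_orbit Sym_permutation)

lemma Sym_orbit_subset: "\<sigma> \<in> Sym n \<Longrightarrow> x \<in> {1..n} \<Longrightarrow> orbit \<sigma> x \<subseteq> {1..n}"
  by (rule permutes_orbit_subset) auto

lemma Sym_in: "\<sigma> \<in> Sym n \<Longrightarrow> x \<in> {1..n} \<Longrightarrow> \<sigma> x \<in> {1..n}"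
  using permutes_in_image by fastforce

lemma finite_points_of_period: "finite (points_of_period n L \<tau>)"
  by (simp add: points_of_period_def)

text \<open>The cycles of length \<open>L\<close> are pairwise disjoint, and their union is the set
  of points of period \<open>L\<close>.\<close>

lemma card_points_of_period:
  assumes "\<tau> \<in> Sym n"
  shows "card (points_of_period n L \<tau>) = L * num_cycles n L \<tau>"
proof -
  let ?C = "{C. C \<subseteq> {1..n} \<and> cyclic_on \<tau> C \<and> card C = L}"
  have "finite ?C" by (rule finite_subset[of _ "Pow {1..n}"]) auto
  have "\<Union>?C = points_of_period n L \<tau>"
  proof (intro equalityI subsetI)
    fix x assume "x \<in> \<Union>?C"
    then obtain C where "x \<in> C" "C \<subseteq> {1..n}" "cyclic_on \<tau> C" "card C = L" by blast
    then show "x \<in> points_of_period n L \<tau>"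
      using orbit_cyclic_eq3[of \<tau> C x] by (auto simp: points_of_period_def)
  next
    fix x assume "x \<in> points_of_period n L \<tau>"
    then have "x \<in> {1..n}" "card (orbit \<tau> x) = L" by (auto simp: points_of_period_def)
    moreover have "cyclic_on \<tau> (orbit \<tau> x)" using assms by (intro cyclic_on_orbit) auto
    ultimately show "x \<in> \<Union>?C"
      using Sym_orbit_subset[OF assms] Sym_self_in_orbit[OF assms] by blast
  qed
  moreover have "L * card ?C = card (\<Union>?C)"
  proof (rule card_partition)
    show "finite (\<Union>?C)" using calculation finite_points_of_period by metis
    fix c1 c2 assume *: "c1 \<in> ?C" "c2 \<in> ?C" "c1 \<noteq> c2"
    have "c1 = c2" if "x \<in> c1" "x \<in> c2" for x
      using * orbit_cyclic_eq3[of \<tau> c1 x] orbit_cyclic_eq3[of \<tau> c2 x] that by simp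
    then show "c1 \<inter> c2 = {}" using \<open>c1 \<noteq> c2\<close> by blast
  qed (use \<open>finite ?C\<close> in auto)
  ultimately show ?thesis by (simp add: num_cycles_def)
qed

text \<open>The size of the orbit is the first return time \<open>funpow_dist1 f y y\<close>, so
  facts about the return time become facts about the cardinality.\<close>

lemma
  assumes "y \<in> orbit f y"
  shows funpow_card_orbit: "(f ^^ card (orbit f y)) y = y"
    and inj_on_funpow_card_orbit: "inj_on (\<lambda>m. (f ^^ m) y) {..<card (orbit f y)}"
proof -
  have inj: "inj_on (\<lambda>n. (f ^^ n) y) {0..<funpow_dist1 f y y}"
    by (rule inj_on_funpow_dist1[OF assms])
  have "card (orbit f y) = funpow_dist1 f y y"
    by (subst orbit_conv_funpow_dist1[OF assms]) (simp only: card_image[OF inj], simp)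
  then show "(f ^^ card (orbit f y)) y = y" "inj_on (\<lambda>m. (f ^^ m) y) {..<card (orbit f y)}"
    using funpow_dist1_prop[OF assms] inj by (simp_all only: atLeast0LessThan)
qed

section \<open>Appending a cycle to a permutation\<close>

lemma append_cycle_permutes:
  assumes "\<sigma> \<in> Sym p"
  shows "append_cycle p L \<sigma> \<in> Sym (p + L)"
proof -
  let ?s = "append_cycle p L \<sigma>"
  have s: "\<sigma> permutes {1..p}" using assms by simp
  \<comment> \<open>The branch \<open>x \<le> p\<close> of \<open>append_cycle\<close> also covers
    0, which lies outside \<open>{1..p}\<close>.\<close>
  have 0: "\<sigma> 0 = 0" using permutes_not_in[OF s] by simp
  have le: "\<sigma> x \<le> p" if "x \<le> p" for x
    using Sym_in[OF assms, of x] 0 that by (cases "x = 0") auto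
  have "?s x \<in> {1..p+L}" if "x \<in> {1..p+L}" for x
    using that Sym_in[OF assms, of x] by (auto simp: append_cycle_def)
  then have sub: "?s ` {1..p+L} \<subseteq> {1..p+L}" by blast
  have "inj_on ?s {1..p+L}"
  proof (rule inj_onI)
    fix x y assume "?s x = ?s y"
    moreover have "\<sigma> x = \<sigma> y \<longleftrightarrow> x = y" by (rule inj_eq[OF permutes_inj[OF s]])
    ultimately show "x = y"
      using le[of x] le[of y]
      by (cases "x \<le> p"; cases "y \<le> p") (simp_all add: append_cycle_def split: if_splits)
  qed
  then have "bij_betw ?s {1..p+L} {1..p+L}"
    using sub by (simp add: bij_betw_def endo_inj_surj)
  moreover have "?s x = x" if "x \<notin> {1..p+L}" for x
    using that 0 by (cases "x = 0") (auto simp: append_cycle_def)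
  ultimately show ?thesis by (auto intro: bij_imp_permutes)
qed

lemma orbit_append_cycle_old:
  assumes "\<sigma> \<in> Sym p" "x \<in> {1..p}"
  shows "orbit (append_cycle p L \<sigma>) x = orbit \<sigma> x"
proof (rule orbit_cong)
  show "x \<in> orbit \<sigma> x" by (rule Sym_self_in_orbit[OF assms(1)])
  fix s assume "s \<in> orbit \<sigma> x"
  then have "s \<in> {1..p}" using Sym_orbit_subset[OF assms] by blast
  then show "append_cycle p L \<sigma> s = \<sigma> s" by (simp add: append_cycle_def)
qed

text \<open>From \<open>Suc p\<close>, \<open>j < L\<close> steps lead to \<open>Suc p + j\<close>,
  and step \<open>L\<close> closes the cycle. Every other point of a cyclic set has the same
  orbit.\<close>

lemma orbit_append_cycle_new:
  assumes "\<sigma> \<in> Sym p" "x \<in> {Suc p..p+L}"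
  shows "orbit (append_cycle p L \<sigma>) x = {Suc p..p+L}"
proof -
  let ?s = "append_cycle p L \<sigma>"
  have L: "L \<ge> 1" using assms(2) by auto
  have pow: "(?s ^^ j) (Suc p) = Suc p + j" if "j < L" for j
    using that by (induction j) (auto simp: append_cycle_def)
  obtain K where K: "L = Suc K" using L by (cases L) auto
  have "(?s ^^ L) (Suc p) = Suc p"
    using pow[of K] by (simp add: K append_cycle_def)
  from orbit_altdef_bounded[OF this] L
  have "orbit ?s (Suc p) = {(?s ^^ m) (Suc p) | m. m < L}" by simp
  also have "\<dots> = {Suc p + m | m. m < L}" using pow by force
  also have "\<dots> = {Suc p..p+L}"
  proof (intro equalityI subsetI)
    fix y assume "y \<in> {Suc p..p+L}"
    then have "y = Suc p + (y - Suc p)" "y - Suc p < L" by auto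
    then show "y \<in> {Suc p + m | m. m < L}" by blast
  qed auto
  finally have eq: "orbit ?s (Suc p) = {Suc p..p+L}" .
  then have "cyclic_on ?s {Suc p..p+L}" using L by (intro cyclic_on_singleI[of "Suc p"]) auto
  from orbit_cyclic_eq3[OF this assms(2)] show ?thesis .
qed

text \<open>Old points keep their period and the new ones have period \<open>L\<close>. Comparing
  the numbers of points of period \<open>M\<close> and dividing by \<open>M\<close> gives the
  numbers of cycles.\<close>

lemma num_cycles_append_cycle:
  assumes "\<sigma> \<in> Sym p" "L \<ge> 1" "M \<ge> 1"
  shows "num_cycles (p + L) M (append_cycle p L \<sigma>) = num_cycles p M \<sigma> + (if M = L then 1 else 0)"
proof -
  let ?s = "append_cycle p L \<sigma>"
  let ?N = "if M = L then {Suc p..p+L} else {}"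
  have "x \<in> points_of_period (p + L) M ?s \<longleftrightarrow> x \<in> points_of_period p M \<sigma> \<union> ?N" for x
  proof (cases "x \<in> {1..p}")
    case True
    then show ?thesis using orbit_append_cycle_old[OF assms(1)] by (simp add: points_of_period_def)
  next
    case False
    then show ?thesis
      using orbit_append_cycle_new[OF assms(1), of x L]
      by (cases "x \<in> {Suc p..p+L}") (auto simp: points_of_period_def)
  qed
  then have "points_of_period (p + L) M ?s = points_of_period p M \<sigma> \<union> ?N" by blast
  then have "card (points_of_period (p + L) M ?s) = card (points_of_period p M \<sigma>) + card ?N"
    using finite_points_of_period[of p M \<sigma>]
    by (simp, subst card_Un_disjoint) (auto simp: points_of_period_def)
  then have "M * num_cycles (p + L) M ?s = M * (num_cycles p M \<sigma> + (if M = L then 1 else 0))"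
    using append_cycle_permutes[OF assms(1)] assms(1)
    by (simp only: card_points_of_period) (simp add: algebra_simps)
  then show ?thesis using assms(3) by simp
qed

section \<open>Extending equivariant injections over an appended cycle\<close>

lemma orbit_equivariant:
  assumes "\<sigma> \<in> Sym p" "\<forall>x\<in>{1..p}. \<tau> (\<phi> x) = \<phi> (\<sigma> x)" "x \<in> {1..p}"
  shows "orbit \<tau> (\<phi> x) = \<phi> ` orbit \<sigma> x"
proof -
  have "\<phi> ` orbit \<sigma> x = orbit \<tau> (\<phi> x)"
    using assms Sym_orbit_subset[OF assms(1,3)]
    by (intro orbit_inverse Sym_self_in_orbit[OF assms(1)]) blast
  then show ?thesis by simp
qed

lemma card_orbit_equivariant:
  assumes "\<sigma> \<in> Sym p" "\<forall>x\<in>{1..p}. \<tau> (\<phi> x) = \<phi> (\<sigma> x)" "x \<in> {1..p}" "inj_on \<phi> {1..p}"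
  shows "card (orbit \<tau> (\<phi> x)) = card (orbit \<sigma> x)"
  unfolding orbit_equivariant[OF assms(1-3)]
  by (rule card_image[OF inj_on_subset[OF assms(4) Sym_orbit_subset[OF assms(1,3)]]])

text \<open>Since \<open>\<phi>\<close> preserves periods, the points of period \<open>L\<close> in
  its image are exactly the images of the points of period \<open>L\<close> of
  \<open>\<sigma>\<close>. What is left are the possible starting points for one more cycle.\<close>

lemma card_new_points:
  assumes "\<sigma> \<in> Sym p" "\<tau> \<in> Sym n" "\<phi> \<in> equivariant_injections p \<sigma> n \<tau>"
  shows "card (points_of_period n L \<tau> - \<phi> ` {1..p}) = L * (num_cycles n L \<tau> - num_cycles p L \<sigma>)"
proof -
  have phi: "\<phi> \<in> {1..p} \<rightarrow>\<^sub>E {1..n}" "inj_on \<phi> {1..p}" "\<forall>x\<in>{1..p}. \<tau> (\<phi> x) = \<phi> (\<sigma> x)"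
    using assms(3) by (auto simp: equivariant_injections_def)
  have *: "points_of_period n L \<tau> \<inter> \<phi> ` {1..p} = \<phi> ` points_of_period p L \<sigma>"
    using card_orbit_equivariant[OF assms(1) phi(3) _ phi(2)] PiE_mem[OF phi(1)]
    by (auto simp: points_of_period_def)
  have "card (\<phi> ` points_of_period p L \<sigma>) = card (points_of_period p L \<sigma>)"
    by (intro card_image inj_on_subset[OF phi(2)]) (auto simp: points_of_period_def)
  then have "card (points_of_period n L \<tau> \<inter> \<phi> ` {1..p}) = L * num_cycles p L \<sigma>"
    by (simp only: * card_points_of_period[OF assms(1)])
  moreover have "card (points_of_period n L \<tau> - \<phi> ` {1..p}) =
      card (points_of_period n L \<tau>) - card (points_of_period n L \<tau> \<inter> \<phi> ` {1..p})"
    by (intro card_Diff_subset_Int) simp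
  ultimately show ?thesis
    by (simp only: card_points_of_period[OF assms(2)] diff_mult_distrib2)
qed

text \<open>The new cycle follows the \<open>\<tau>\<close>-orbit of \<open>y\<close>:
  \<open>Suc p\<close> goes to \<open>y\<close>, and equivariance then forces the other
  values.\<close>

definition extend_injection ::
    "nat \<Rightarrow> nat \<Rightarrow> (nat \<Rightarrow> nat) \<Rightarrow> (nat \<Rightarrow> nat) \<Rightarrow> nat \<Rightarrow> nat \<Rightarrow> nat" where
  "extend_injection p L \<tau> \<phi> y =
     (\<lambda>x\<in>{1..p+L}. if x \<le> p then \<phi> x else (\<tau> ^^ (x - Suc p)) y)"

text \<open>The period \<open>L\<close> of \<open>y\<close> makes the new values distinct and closes
  the cycle; they avoid the old values because the image of \<open>\<phi>\<close> is a union of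
  \<open>\<tau>\<close>-orbits that does not contain \<open>y\<close>.\<close>

lemma extend_injection:
  assumes s: "\<sigma> \<in> Sym p" and t: "\<tau> \<in> Sym n" and L: "L \<ge> 1"
    and phi: "\<phi> \<in> equivariant_injections p \<sigma> n \<tau>"
    and y: "y \<in> points_of_period n L \<tau> - \<phi> ` {1..p}"
  shows "extend_injection p L \<tau> \<phi> y \<in> equivariant_injections (p + L) (append_cycle p L \<sigma>) n \<tau>"
proof -
  let ?e = "extend_injection p L \<tau> \<phi> y"
  have phi: "\<phi> \<in> {1..p} \<rightarrow>\<^sub>E {1..n}" "inj_on \<phi> {1..p}" "\<forall>x\<in>{1..p}. \<tau> (\<phi> x) = \<phi> (\<sigma> x)"
    using phi by (auto simp: equivariant_injections_def)
  have y1: "y \<in> {1..n}" "card (orbit \<tau> y) = L" "y \<notin> \<phi> ` {1..p}"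
    using y by (auto simp: points_of_period_def)
  have self: "y \<in> orbit \<tau> y" by (rule Sym_self_in_orbit[OF t])
  have orb: "(\<tau> ^^ j) y \<in> orbit \<tau> y" for j by (rule funpow_in_orbit[OF self])
  then have range: "(\<tau> ^^ j) y \<in> {1..n}" for j using Sym_orbit_subset[OF t y1(1)] by blast
  \<comment> \<open>If an iterate of \<open>y\<close> were in the image of \<open>\<phi>\<close>,
    its whole orbit would be there, and hence \<open>y\<close> itself.\<close>
  have cross: "(\<tau> ^^ j) y \<noteq> \<phi> x" if "x \<in> {1..p}" for x j
  proof
    assume "(\<tau> ^^ j) y = \<phi> x"
    then have "y \<in> orbit \<tau> (\<phi> x)" using orbit_swap[OF self orb[of j]] by simp
    then have "y \<in> \<phi> ` orbit \<sigma> x" using orbit_equivariant[OF s phi(3) that] by simp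
    then show False using y1(3) Sym_orbit_subset[OF s that] by blast
  qed
  have period: "(\<tau> ^^ L) y = y" and inj: "inj_on (\<lambda>m. (\<tau> ^^ m) y) {..<L}"
    using funpow_card_orbit[OF self] inj_on_funpow_card_orbit[OF self] y1(2) by simp_all
  have "?e \<in> {1..p+L} \<rightarrow>\<^sub>E {1..n}"
  proof (rule PiE_I)
    fix x assume "x \<in> {1..p+L}"
    then show "?e x \<in> {1..n}"
      using PiE_mem[OF phi(1), of x] range by (auto simp: extend_injection_def)
  qed (auto simp: extend_injection_def)
  moreover have "inj_on ?e {1..p+L}"
  proof (rule inj_onI)
    fix a b assume ab: "a \<in> {1..p+L}" "b \<in> {1..p+L}" and eq: "?e a = ?e b"
    consider "a \<le> p" "b \<le> p" | "a \<le> p" "b > p" | "a > p" "b \<le> p" | "a > p" "b > p" by linarith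
    then show "a = b"
    proof cases
      case 1
      then show ?thesis using ab eq inj_onD[OF phi(2), of a b] by (simp add: extend_injection_def)
    next
      case 2
      then show ?thesis using ab eq cross[of a "b - Suc p"] by (simp add: extend_injection_def)
    next
      case 3
      then show ?thesis using ab eq cross[of b "a - Suc p"] by (simp add: extend_injection_def)
    next
      case 4
      then have "a - Suc p = b - Suc p"
        using ab eq inj_onD[OF inj, of "a - Suc p" "b - Suc p"]
        by (auto simp: extend_injection_def)
      then show ?thesis using 4 by simp
    qed
  qed
  moreover have "\<tau> (?e x) = ?e (append_cycle p L \<sigma> x)" if x: "x \<in> {1..p+L}" for x
  proof (cases "x \<le> p")
    case True
    then show ?thesis using x phi(3) Sym_in[OF s, of x]
      by (simp add: extend_injection_def append_cycle_def)
  next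
    case False
    show ?thesis
    proof (cases "x < p + L")
      case True
      then have "x - p = Suc (x - Suc p)" using False by simp
      then show ?thesis using True False x by (simp add: extend_injection_def append_cycle_def)
    next
      case nlt: False
      \<comment> \<open>At the last point of the new cycle \<open>append_cycle\<close> jumps back to
        \<open>Suc p\<close>, which matches \<open>(\<tau> ^^ L) y = y\<close>.\<close>
      then have xe: "x = p + L" using x by simp
      obtain K where K: "L = Suc K" using L by (cases L) auto
      show ?thesis using period
        by (simp add: extend_injection_def append_cycle_def xe K)
    qed
  qed
  ultimately show ?thesis by (simp add: equivariant_injections_def)
qed

text \<open>This inverts the extension: the restriction to \<open>{1..p}\<close> and the value at
  \<open>Suc p\<close> determine \<open>\<psi>\<close>.\<close>

lemma restrict_injection:
  assumes s: "\<sigma> \<in> Sym p" and t: "\<tau> \<in> Sym n" and L: "L \<ge> 1"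
    and psi: "\<psi> \<in> equivariant_injections (p + L) (append_cycle p L \<sigma>) n \<tau>"
  shows "restrict \<psi> {1..p} \<in> equivariant_injections p \<sigma> n \<tau>"
    and "\<psi> (Suc p) \<in> points_of_period n L \<tau> - restrict \<psi> {1..p} ` {1..p}"
    and "extend_injection p L \<tau> (restrict \<psi> {1..p}) (\<psi> (Suc p)) = \<psi>"
proof -
  let ?s = "append_cycle p L \<sigma>"
  have psi: "\<psi> \<in> {1..p+L} \<rightarrow>\<^sub>E {1..n}" "inj_on \<psi> {1..p+L}" "\<forall>x\<in>{1..p+L}. \<tau> (\<psi> x) = \<psi> (?s x)"
    using psi by (auto simp: equivariant_injections_def)
  have "inj_on (restrict \<psi> {1..p}) {1..p}"
    unfolding inj_on_restrict_eq by (rule inj_on_subset[OF psi(2)]) auto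
  moreover have "\<tau> (restrict \<psi> {1..p} x) = restrict \<psi> {1..p} (\<sigma> x)" if "x \<in> {1..p}" for x
    using that psi(3) Sym_in[OF s that] by (auto simp: append_cycle_def)
  moreover have "restrict \<psi> {1..p} \<in> {1..p} \<rightarrow>\<^sub>E {1..n}"
    using PiE_mem[OF psi(1)] by (intro restrict_PiE_iff[THEN iffD2]) auto
  ultimately show old: "restrict \<psi> {1..p} \<in> equivariant_injections p \<sigma> n \<tau>"
    unfolding equivariant_injections_def by blast
  \<comment> \<open>The point \<open>Suc p\<close> lies on the appended cycle, and equivariant
    injections preserve the cycle length.\<close>
  have "card (orbit \<tau> (\<psi> (Suc p))) = L"
    using card_orbit_equivariant[OF append_cycle_permutes[OF s] psi(3) _ psi(2)]
      orbit_append_cycle_new[OF s, of "Suc p" L] L by simp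
  moreover have "\<psi> (Suc p) \<notin> \<psi> ` {1..p}"
    using inj_onD[OF psi(2), of "Suc p"] L by fastforce
  moreover have "\<psi> (Suc p) \<in> {1..n}" using PiE_mem[OF psi(1), of "Suc p"] L by simp
  ultimately show new: "\<psi> (Suc p) \<in> points_of_period n L \<tau> - restrict \<psi> {1..p} ` {1..p}"
    by (auto simp: points_of_period_def)
  have pow: "(\<tau> ^^ j) (\<psi> (Suc p)) = \<psi> (Suc p + j)" if "j < L" for j
    using that
  proof (induction j)
    case (Suc j)
    then have "(\<tau> ^^ Suc j) (\<psi> (Suc p)) = \<tau> (\<psi> (Suc p + j))" by simp
    also have "\<dots> = \<psi> (?s (Suc p + j))" using psi(3) Suc.prems by simp
    also have "?s (Suc p + j) = Suc p + Suc j" using Suc.prems by (simp add: append_cycle_def)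
    finally show ?case .
  qed simp
  show "extend_injection p L \<tau> (restrict \<psi> {1..p}) (\<psi> (Suc p)) = \<psi>"
  proof (rule PiE_ext)
    fix x assume "x \<in> {1..p+L}"
    then show "extend_injection p L \<tau> (restrict \<psi> {1..p}) (\<psi> (Suc p)) x = \<psi> x"
      using pow[of "x - Suc p"] by (auto simp: extend_injection_def)
  next
    show "extend_injection p L \<tau> (restrict \<psi> {1..p}) (\<psi> (Suc p)) \<in> {1..p+L} \<rightarrow>\<^sub>E {1..n}"
      using extend_injection[OF s t L old new] unfolding equivariant_injections_def by blast
  qed (rule psi(1))
qed

text \<open>An injection for the longer permutation is a pair of an injection \<open>\<phi>\<close>
  for \<open>\<sigma>\<close> and a starting point for the new cycle, and the number of starting
  points is the same for every \<open>\<phi>\<close>. If the difference truncates to 0, there is no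
  injection for the longer permutation.\<close>

lemma card_equivariant_injections_append_cycle:
  assumes s: "\<sigma> \<in> Sym p" and t: "\<tau> \<in> Sym n" and L: "L \<ge> 1"
  shows "card (equivariant_injections (p + L) (append_cycle p L \<sigma>) n \<tau>) =
    card (equivariant_injections p \<sigma> n \<tau>) * (L * (num_cycles n L \<tau> - num_cycles p L \<sigma>))"
proof -
  let ?E = "equivariant_injections p \<sigma> n \<tau>"
  let ?E' = "equivariant_injections (p + L) (append_cycle p L \<sigma>) n \<tau>"
  let ?S = "SIGMA \<phi>:?E. points_of_period n L \<tau> - \<phi> ` {1..p}"
  have "bij_betw (\<lambda>\<psi>. (restrict \<psi> {1..p}, \<psi> (Suc p))) ?E' ?S"
  proof (rule bij_betw_byWitness[where f' = "\<lambda>(\<phi>, y). extend_injection p L \<tau> \<phi> y"])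
    show "\<forall>\<psi>\<in>?E'. (\<lambda>(\<phi>, y). extend_injection p L \<tau> \<phi> y) (restrict \<psi> {1..p}, \<psi> (Suc p)) = \<psi>"
      using restrict_injection(3)[OF s t L] by simp
    show "\<forall>z\<in>?S. (\<lambda>\<psi>. (restrict \<psi> {1..p}, \<psi> (Suc p)))
        ((\<lambda>(\<phi>, y). extend_injection p L \<tau> \<phi> y) z) = z"
      using L by (auto simp: extend_injection_def equivariant_injections_def PiE_iff
          restrict_def extensional_def fun_eq_iff)
    show "(\<lambda>\<psi>. (restrict \<psi> {1..p}, \<psi> (Suc p))) ` ?E' \<subseteq> ?S"
      by (intro image_subsetI SigmaI restrict_injection(1,2)[OF s t L])
    show "(\<lambda>(\<phi>, y). extend_injection p L \<tau> \<phi> y) ` ?S \<subseteq> ?E'"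
      using extend_injection[OF s t L] by auto
  qed
  then have "card ?E' = card ?S" by (rule bij_betw_same_card)
  also have "\<dots> = (\<Sum>\<phi>\<in>?E. card (points_of_period n L \<tau> - \<phi> ` {1..p}))"
  proof (intro card_SigmaI)
    show "finite ?E"
      by (rule finite_subset[of _ "{1..p} \<rightarrow>\<^sub>E {1..n}"])
        (auto simp: equivariant_injections_def intro: finite_PiE)
  qed (simp add: finite_points_of_period)
  also have "\<dots> = (\<Sum>\<phi>\<in>?E. L * (num_cycles n L \<tau> - num_cycles p L \<sigma>))"
    using card_new_points[OF s t] by (intro sum.cong) auto
  finally show ?thesis by simp
qed

text \<open>Induction on the number of cycles: one cycle of some length \<open>l j\<close> is taken
  away and appended again. The same \<open>\<sigma>\<close> must carry both the cycle counts and the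
  counting formula, since the new factor depends on the counts of \<open>\<sigma>\<close>. As
  \<open>l\<close> is injective, only the count with index \<open>j\<close> changes.\<close>

lemma exists_permutation_with_cycle_type:
  fixes k l :: "'i \<Rightarrow> nat"
  assumes "finite I" "inj_on l I" "\<forall>i\<in>I. l i \<ge> 1"
  shows "\<exists>\<sigma>\<in>Sym (\<Sum>i\<in>I. k i * l i).
    (\<forall>i\<in>I. num_cycles (\<Sum>i\<in>I. k i * l i) (l i) \<sigma> = k i) \<and>
    (\<forall>n. \<forall>\<tau>\<in>Sym n. card (equivariant_injections (\<Sum>i\<in>I. k i * l i) \<sigma> n \<tau>) =
      (\<Prod>i\<in>I. l i ^ k i * fact (k i) * (num_cycles n (l i) \<tau> choose k i)))"
proof (induction "\<Sum>i\<in>I. k i" arbitrary: k)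
  case 0
  then have k: "k i = 0" if "i \<in> I" for i using assms(1) that by simp
  then have p: "(\<Sum>i\<in>I. k i * l i) = 0" by simp
  have "num_cycles 0 (l i) (\<lambda>x. x) = 0" if "i \<in> I" for i
  proof -
    have "{C. C \<subseteq> {1..0::nat} \<and> cyclic_on (\<lambda>x. x) C \<and> card C = l i} = {}"
      using assms(3) that by fastforce
    then show ?thesis by (simp only: num_cycles_def card.empty)
  qed
  \<comment> \<open>The empty map has the single extensional representative
    \<open>\<lambda>_. undefined\<close>, which agrees with a product whose factors are all
    1.\<close>
  moreover have "equivariant_injections 0 (\<lambda>x. x) n \<tau> = {\<lambda>_. undefined}" for n \<tau>
    by (auto simp: equivariant_injections_def)
  ultimately show ?case unfolding p using k
    by (intro bexI[of _ "\<lambda>x. x"]) (auto simp: permutes_def)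
next
  case (Suc m)
  then obtain j where j: "j \<in> I" "k j > 0"
    by (metis gr0I sum.neutral Zero_not_Suc)
  define k' where "k' = k(j := k j - 1)"
  have k'I: "k' i = k i" if "i \<in> I - {j}" for i using that by (simp add: k'_def)
  have kj: "k j = Suc (k' j)" using j by (simp add: k'_def)
  have "(\<Sum>i\<in>I. k i) = Suc (\<Sum>i\<in>I. k' i)"
    using j(1) assms(1) k'I kj by (simp add: sum.remove)
  with Suc(2) have "m = (\<Sum>i\<in>I. k' i)" by simp
  from Suc(1)[OF this] obtain \<sigma> where s: "\<sigma> \<in> Sym (\<Sum>i\<in>I. k' i * l i)"
    and nc: "\<forall>i\<in>I. num_cycles (\<Sum>i\<in>I. k' i * l i) (l i) \<sigma> = k' i"
    and card: "\<forall>n. \<forall>\<tau>\<in>Sym n. card (equivariant_injections (\<Sum>i\<in>I. k' i * l i) \<sigma> n \<tau>) =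
      (\<Prod>i\<in>I. l i ^ k' i * fact (k' i) * (num_cycles n (l i) \<tau> choose k' i))" by blast
  let ?p = "\<Sum>i\<in>I. k' i * l i"
  let ?s = "append_cycle ?p (l j) \<sigma>"
  have lj: "l j \<ge> 1" using assms(3) j(1) by blast
  have p: "(\<Sum>i\<in>I. k i * l i) = ?p + l j"
    using j(1) assms(1) k'I kj by (simp add: sum.remove)
  have "num_cycles (?p + l j) (l i) ?s = k i" if "i \<in> I" for i
    using num_cycles_append_cycle[OF s lj, of "l i"] assms(3) that nc
      inj_onD[OF assms(2), of i j] j by (cases "i = j") (auto simp: k'_def Suc_diff_Suc)
  moreover have "card (equivariant_injections (?p + l j) ?s n \<tau>) =
      (\<Prod>i\<in>I. l i ^ k i * fact (k i) * (num_cycles n (l i) \<tau> choose k i))"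
    if t: "\<tau> \<in> Sym n" for n \<tau>
  proof -
    let ?g = "\<lambda>k i. l i ^ k i * fact (k i) * (num_cycles n (l i) \<tau> choose k i)"
    have "card (equivariant_injections (?p + l j) ?s n \<tau>) =
        (\<Prod>i\<in>I. ?g k' i) * (l j * (num_cycles n (l j) \<tau> - k' j))"
      using card_equivariant_injections_append_cycle[OF s t lj] card t nc j(1) by simp
    also have "(\<Prod>i\<in>I. ?g k' i) = ?g k' j * (\<Prod>i\<in>I-{j}. ?g k' i)"
      using assms(1) j(1) by (rule prod.remove)
    also have "(\<Prod>i\<in>I-{j}. ?g k' i) = (\<Prod>i\<in>I-{j}. ?g k i)"
      using k'I by (intro prod.cong) auto
    also have "?g k' j * (\<Prod>i\<in>I-{j}. ?g k i) * (l j * (num_cycles n (l j) \<tau> - k' j)) =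
        l j ^ Suc (k' j) * fact (k' j) *
          ((num_cycles n (l j) \<tau> - k' j) * (num_cycles n (l j) \<tau> choose k' j)) * (\<Prod>i\<in>I-{j}. ?g k i)"
      by (simp add: mult_ac)
    \<comment> \<open>This absorption identity turns the new factor into the step from
      \<open>k' j\<close> to \<open>k j\<close>. It also holds with truncated subtraction, where
      both sides are 0.\<close>
    also have "(num_cycles n (l j) \<tau> - k' j) * (num_cycles n (l j) \<tau> choose k' j) =
        Suc (k' j) * (num_cycles n (l j) \<tau> choose Suc (k' j))"
      by (metis binomial_absorb_comp binomial_absorption)
    also have "l j ^ Suc (k' j) * fact (k' j) *
          (Suc (k' j) * (num_cycles n (l j) \<tau> choose Suc (k' j))) * (\<Prod>i\<in>I-{j}. ?g k i) =
        ?g k j * (\<Prod>i\<in>I-{j}. ?g k i)"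
      unfolding kj fact_Suc by (simp add: algebra_simps)
    also have "\<dots> = (\<Prod>i\<in>I. ?g k i)" using assms(1) j(1) by (rule prod.remove[symmetric])
    finally show ?thesis .
  qed
  ultimately show ?case unfolding p using append_cycle_permutes[OF s, of "l j"] by blast
qed

section \<open>Convergence of the binomial moments\<close>

text \<open>The complements of \<open>{1..p}\<close> and of its image in \<open>{1..n}\<close> have
  equal size, so any bijection between them completes \<open>\<phi>\<close>.\<close>

lemma exists_permutation_extending:
  assumes "\<phi> \<in> {1..p} \<rightarrow>\<^sub>E {1..n}" "inj_on \<phi> {1..p}" "p \<le> n"
  shows "\<exists>g\<in>Sym n. \<forall>x\<in>{1..p}. g x = \<phi> x"
proof -
  let ?B = "{1..n} - {1..p}" and ?C = "{1..n} - \<phi> ` {1..p}"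
  have sub: "\<phi> ` {1..p} \<subseteq> {1..n}" using assms(1) by auto
  have "card ?B = card ?C"
    using assms(2,3) sub by (subst (1 2) card_Diff_subset) (auto simp: card_image)
  then obtain h where h: "bij_betw h ?B ?C"
    using finite_same_card_bij[of ?B ?C] by auto
  define g where "g x = (if x \<in> {1..p} then \<phi> x else if x \<in> ?B then h x else x)" for x
  have "bij_betw g {1..p} (\<phi> ` {1..p})"
    using inj_on_imp_bij_betw[OF assms(2)]
    by (rule bij_betw_cong[THEN iffD1, rotated]) (simp add: g_def)
  moreover have "bij_betw g ?B ?C"
    using h by (rule bij_betw_cong[THEN iffD1, rotated]) (auto simp: g_def)
  ultimately have "bij_betw g ({1..p} \<union> ?B) (\<phi> ` {1..p} \<union> ?C)"
    by (rule bij_betw_combine) auto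
  moreover have "{1..p} \<union> ?B = {1..n}" "\<phi> ` {1..p} \<union> ?C = {1..n}"
    using assms(3) sub by auto
  ultimately have "bij_betw g {1..n} {1..n}" by simp
  moreover have "g x = x" if "x \<notin> {1..n}" for x using that assms(3) by (auto simp: g_def)
  ultimately have "g permutes {1..n}" by (rule bij_imp_permutes)
  then show ?thesis by (intro bexI[of _ g]) (auto simp: g_def)
qed

section \<open>The expected number of equivariant injections\<close>

lemma finite_Sym: "finite (Sym n)"
  by (simp add: finite_permutations)

lemma measure_eq_sum_singletons:
  assumes "prob_space M" "sets M = Pow S" "finite T" "T \<subseteq> S"
  shows "measure M T = (\<Sum>x\<in>T. measure M {x})"
proof -
  interpret prob_space M by fact
  show ?thesis using assms by (intro finite_measure_eq_sum_singleton) auto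
qed

text \<open>Let \<open>g\<close> be a permutation that extends \<open>\<phi>\<close>. Then
  \<open>\<tau> \<circ> \<phi> = \<phi> \<circ> \<sigma>\<close> holds on \<open>{1..p}\<close>
  exactly when \<open>inv g \<circ> \<tau> \<circ> g\<close> agrees with \<open>\<sigma>\<close>
  there, so conjugation by \<open>g\<close> matches the two events.\<close>

lemma conj_invariant_measure_equivariant:
  assumes P: "prob_space P" "sets P = Pow (Sym n)" and inv: "conj_invariant n P"
    and s: "\<sigma> \<in> Sym p" and "p \<le> n"
    and phi: "\<phi> \<in> {1..p} \<rightarrow>\<^sub>E {1..n}" "inj_on \<phi> {1..p}"
  shows "measure P {\<tau>\<in>Sym n. \<forall>x\<in>{1..p}. \<tau> (\<phi> x) = \<phi> (\<sigma> x)} =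
    measure P {\<tau>\<in>Sym n. \<forall>x\<in>{1..p}. \<tau> x = \<sigma> x}" (is "measure P ?T1 = measure P ?T0")
proof -
  obtain g where g: "g \<in> Sym n" "\<And>x. x \<in> {1..p} \<Longrightarrow> g x = \<phi> x"
    using exists_permutation_extending[OF phi \<open>p \<le> n\<close>] by blast
  have gp: "g permutes {1..n}" using g(1) by simp
  have ig: "inv g permutes {1..n}" by (rule permutes_inv[OF gp])
  have g1: "g (inv g x) = x" "inv g (g x) = x" for x
    using permutes_inverses[OF gp] by auto
  have fin: "finite ?T0" "finite ?T1" using finite_Sym[of n] by auto
  \<comment> \<open>Invariance speaks of single permutations, so the events are compared point by
    point.\<close>
  have "(\<Sum>\<tau>\<in>?T1. measure P {\<tau>}) = (\<Sum>\<tau>\<in>?T0. measure P {\<tau>})"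
  proof (rule sum.reindex_bij_witness[where i = "\<lambda>\<tau>. g \<circ> \<tau> \<circ> inv g" and j = "\<lambda>\<tau>. inv g \<circ> \<tau> \<circ> g"])
    fix \<tau> assume t: "\<tau> \<in> ?T1"
    show "g \<circ> (inv g \<circ> \<tau> \<circ> g) \<circ> inv g = \<tau>" by (simp add: fun_eq_iff g1)
    have m: "inv g \<circ> \<tau> \<circ> g \<in> Sym n"
      using t ig gp by (auto intro!: permutes_compose)
    moreover have "(inv g \<circ> \<tau> \<circ> g) x = \<sigma> x" if "x \<in> {1..p}" for x
      using t that g(2)[OF that] g(2)[OF Sym_in[OF s that]] g1(2)[of "\<sigma> x"] by simp
    ultimately show "inv g \<circ> \<tau> \<circ> g \<in> ?T0" by simp
    have "measure P {g \<circ> (inv g \<circ> \<tau> \<circ> g) \<circ> inv g} = measure P {inv g \<circ> \<tau> \<circ> g}"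
      using inv g(1) m unfolding conj_invariant_def by blast
    then show "measure P {inv g \<circ> \<tau> \<circ> g} = measure P {\<tau>}"
      using \<open>g \<circ> (inv g \<circ> \<tau> \<circ> g) \<circ> inv g = \<tau>\<close> by simp
  next
    fix \<tau> assume t: "\<tau> \<in> ?T0"
    show "inv g \<circ> (g \<circ> \<tau> \<circ> inv g) \<circ> g = \<tau>" by (simp add: fun_eq_iff g1)
    have "g \<circ> \<tau> \<circ> inv g \<in> Sym n"
      using t ig gp by (auto intro!: permutes_compose)
    moreover have "(g \<circ> \<tau> \<circ> inv g) (\<phi> x) = \<phi> (\<sigma> x)" if "x \<in> {1..p}" for x
      using t that g(2)[OF that] g(2)[OF Sym_in[OF s that]] g1(2)[of x] by simp
    ultimately show "g \<circ> \<tau> \<circ> inv g \<in> ?T1" by simp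
  qed
  then show ?thesis
    using fin by (subst (1 2) measure_eq_sum_singletons[OF P]) auto
qed

text \<open>Exchanging the sums over \<open>\<tau>\<close> and \<open>\<phi>\<close> leaves one
  probability per injection. All of these are equal, and the number of injections is a falling
  factorial.\<close>

lemma sum_card_equivariant_injections:
  assumes P: "prob_space P" "sets P = Pow (Sym n)" and inv: "conj_invariant n P"
    and s: "\<sigma> \<in> Sym p" and "p \<le> n"
  shows "(\<Sum>\<tau>\<in>Sym n. measure P {\<tau>} * real (card (equivariant_injections p \<sigma> n \<tau>))) =
    (\<Prod>i<p. real n - real i) * measure P {\<tau>\<in>Sym n. \<forall>x\<in>{1..p}. \<tau> x = \<sigma> x}"
proof -
  define I where "I = {\<phi>\<in>{1..p} \<rightarrow>\<^sub>E {1..n}. inj_on \<phi> {1..p}}"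
  have "finite ({1..p} \<rightarrow>\<^sub>E {1..n})" by (intro finite_PiE) auto
  then have fin: "finite I" by (simp add: I_def)
  have "card I = (\<Prod>i<p. n - i)"
    using card_inj_on_subset_funcset[of "{1..p}" "{1..n}" "{1..p}"]
    by (simp add: I_def atLeast0LessThan)
  also have "real \<dots> = (\<Prod>i<p. real n - real i)"
    unfolding of_nat_prod using \<open>p \<le> n\<close> by (intro prod.cong) auto
  finally have cardI: "real (card I) = (\<Prod>i<p. real n - real i)" .
  let ?eq = "\<lambda>\<tau> \<phi>. \<forall>x\<in>{1..p}. \<tau> (\<phi> x) = \<phi> (\<sigma> x)"
  have "real (card (equivariant_injections p \<sigma> n \<tau>)) = (\<Sum>\<phi>\<in>I. if ?eq \<tau> \<phi> then 1 else 0)" for \<tau>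
  proof -
    have "equivariant_injections p \<sigma> n \<tau> = {\<phi>\<in>I. ?eq \<tau> \<phi>}"
      by (auto simp: equivariant_injections_def I_def)
    then show ?thesis using fin by (simp add: sum.If_cases Int_def)
  qed
  then have "(\<Sum>\<tau>\<in>Sym n. measure P {\<tau>} * real (card (equivariant_injections p \<sigma> n \<tau>))) =
      (\<Sum>\<tau>\<in>Sym n. \<Sum>\<phi>\<in>I. if ?eq \<tau> \<phi> then measure P {\<tau>} else 0)"
    by (simp add: sum_distrib_left if_distrib cong: if_cong)
  also have "\<dots> = (\<Sum>\<phi>\<in>I. \<Sum>\<tau>\<in>Sym n. if ?eq \<tau> \<phi> then measure P {\<tau>} else 0)"
    by (rule sum.swap)
  also have "\<dots> = (\<Sum>\<phi>\<in>I. \<Sum>\<tau>\<in>{\<tau>\<in>Sym n. ?eq \<tau> \<phi>}. measure P {\<tau>})"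
    using finite_Sym by (intro sum.cong refl sum.inter_filter[symmetric])
  also have "\<dots> = (\<Sum>\<phi>\<in>I. measure P {\<tau>\<in>Sym n. ?eq \<tau> \<phi>})"
    by (intro sum.cong refl measure_eq_sum_singletons[OF P, symmetric])
      (auto intro: finite_subset[OF _ finite_Sym])
  also have "\<dots> = (\<Sum>\<phi>\<in>I. measure P {\<tau>\<in>Sym n. \<forall>x\<in>{1..p}. \<tau> x = \<sigma> x})"
    by (intro sum.cong refl conj_invariant_measure_equivariant[OF P inv s \<open>p \<le> n\<close>])
      (auto simp: I_def)
  finally show ?thesis by (simp add: cardI)
qed

text \<open>This reconciles the number of injections with the factor \<open>n ^ p\<close> in the
  hypothesis on the limits.\<close>

lemma falling_factorial_asymp: "(\<lambda>n. (\<Prod>i<p. real n - real i) / real n ^ p) \<longlonglongrightarrow> 1"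
proof -
  have "(\<lambda>n. (real n - real i) / real n) \<longlonglongrightarrow> 1" for i
    by real_asymp
  then have "(\<lambda>n. \<Prod>i<p. (real n - real i) / real n) \<longlonglongrightarrow> (\<Prod>i<p. 1)"
    by (intro tendsto_prod)
  then show ?thesis by (simp add: prod_dividef)
qed

lemma at_top_in_le: "at_top_in A \<le> at_top"
  by (simp add: at_top_in_def)

lemma eventually_at_top_inI: "(\<And>n. n \<in> A \<Longrightarrow> n \<ge> m \<Longrightarrow> Q n) \<Longrightarrow> eventually Q (at_top_in A)"
  unfolding at_top_in_def eventually_inf_principal
  by (rule eventually_mono[OF eventually_ge_at_top[of m]]) auto

text \<open>For large \<open>n\<close> the binomial moment is the convergent sequence of the
  hypothesis times the ratio of the falling factorial to \<open>n ^ p\<close>. The factors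
  \<open>l i ^ k i * fact (k i)\<close> from the count of injections cancel those in the
  normalization.\<close>

lemma binomial_moments_tendsto:
  fixes S :: "('i \<Rightarrow> nat) \<Rightarrow> real"
  assumes I: "finite I" "inj_on l I" "\<forall>i\<in>I. l i \<ge> 1"
    and P: "\<And>n. n \<in> A \<Longrightarrow> prob_space (P n) \<and> sets (P n) = Pow (Sym n)"
    and P_inv: "\<And>n. n \<in> A \<Longrightarrow> conj_invariant n (P n)"
    and lim: "\<And>\<sigma>. \<sigma> \<in> Sym p \<Longrightarrow> \<forall>i\<in>I. num_cycles p (l i) \<sigma> = k i \<Longrightarrow>
      ((\<lambda>n. real n ^ p / (\<Prod>i\<in>I. real (l i) ^ k i * fact (k i))
             * measure (P n) {\<tau>\<in>Sym n. \<forall>i\<in>{1..p}. \<tau> i = \<sigma> i}) \<longlongrightarrow> s) (at_top_in A)"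
    and p: "p = (\<Sum>i\<in>I. k i * l i)"
  shows "((\<lambda>n. \<Sum>\<tau>\<in>Sym n. measure (P n) {\<tau>} * (\<Prod>i\<in>I. real (num_cycles n (l i) \<tau> choose k i)))
    \<longlongrightarrow> s) (at_top_in A)"
proof -
  obtain \<sigma> where s: "\<sigma> \<in> Sym p" and nc: "\<forall>i\<in>I. num_cycles p (l i) \<sigma> = k i"
    and card: "\<And>n \<tau>. \<tau> \<in> Sym n \<Longrightarrow> card (equivariant_injections p \<sigma> n \<tau>) =
      (\<Prod>i\<in>I. l i ^ k i * fact (k i) * (num_cycles n (l i) \<tau> choose k i))"
    using exists_permutation_with_cycle_type[OF I, of k] unfolding p[symmetric] by blast
  let ?D = "\<Prod>i\<in>I. real (l i) ^ k i * fact (k i)"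
  have D: "?D \<noteq> 0" using I by (auto simp: prod_zero_iff)
  let ?q = "\<lambda>n. measure (P n) {\<tau>\<in>Sym n. \<forall>i\<in>{1..p}. \<tau> i = \<sigma> i}"
  have "((\<lambda>n. ((\<Prod>i<p. real n - real i) / real n ^ p) * (real n ^ p / ?D * ?q n)) \<longlongrightarrow> 1 * s) (at_top_in A)"
    by (intro tendsto_mult lim[OF s nc] tendsto_mono[OF at_top_in_le falling_factorial_asymp])
  then have *: "((\<lambda>n. ((\<Prod>i<p. real n - real i) / real n ^ p) * (real n ^ p / ?D * ?q n)) \<longlongrightarrow> s) (at_top_in A)"
    by simp
  show ?thesis
  proof (rule Lim_transform_eventually[OF *], rule eventually_at_top_inI)
    \<comment> \<open>The bound \<open>p\<close> lets injections be counted; the bound 1 makes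
      \<open>n ^ p\<close> nonzero.\<close>
    fix n assume n: "n \<in> A" "n \<ge> max 1 p"
    have "?D * (\<Sum>\<tau>\<in>Sym n. measure (P n) {\<tau>} * (\<Prod>i\<in>I. real (num_cycles n (l i) \<tau> choose k i))) =
        (\<Sum>\<tau>\<in>Sym n. measure (P n) {\<tau>} * real (card (equivariant_injections p \<sigma> n \<tau>)))"
      by (simp add: card sum_distrib_left prod.distrib mult_ac)
    also have "\<dots> = (\<Prod>i<p. real n - real i) * ?q n"
      using P[OF n(1)] P_inv[OF n(1)] s n(2) by (intro sum_card_equivariant_injections) auto
    finally show "((\<Prod>i<p. real n - real i) / real n ^ p) * (real n ^ p / ?D * ?q n) =
        (\<Sum>\<tau>\<in>Sym n. measure (P n) {\<tau>} * (\<Prod>i\<in>I. real (num_cycles n (l i) \<tau> choose k i)))"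
      using D n(2) by (simp add: field_simps)
  qed
qed

section \<open>Bonferroni inequalities\<close>

text \<open>These are the indices of the partial sum of order \<open>m\<close> in the series
  hypothesis.\<close>

abbreviation bonferroni_index ::
    "'i set \<Rightarrow> ('i \<Rightarrow> nat) \<Rightarrow> nat \<Rightarrow> ('i \<Rightarrow> nat) set" where
  "bonferroni_index I r m \<equiv>
     {k. k \<in> I \<rightarrow>\<^sub>E UNIV \<and> (\<forall>i\<in>I. k i \<ge> r i) \<and> (\<Sum>i\<in>I. k i - r i) \<le> m}"

section \<open>Alternating sums of products of binomial coefficients\<close>

lemma finite_PiE_sum_le:
  assumes "finite I"
  shows "finite {j \<in> I \<rightarrow>\<^sub>E (UNIV :: nat set). (\<Sum>i\<in>I. j i) \<le> m}"
proof (rule finite_subset)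
  show "{j \<in> I \<rightarrow>\<^sub>E UNIV. (\<Sum>i\<in>I. j i) \<le> m} \<subseteq> I \<rightarrow>\<^sub>E {..m}"
  proof
    fix j assume j: "j \<in> {j \<in> I \<rightarrow>\<^sub>E UNIV. (\<Sum>i\<in>I. j i) \<le> m}"
    then have "j i \<le> m" if "i \<in> I" for i
      using member_le_sum[OF that, of j] assms by auto
    then show "j \<in> I \<rightarrow>\<^sub>E {..m}" using j by (auto simp: PiE_iff)
  qed
  show "finite (I \<rightarrow>\<^sub>E {..m})" using assms by (intro finite_PiE) auto
qed

text \<open>Vandermonde's identity in several variables: one coordinate is split off, and the
  identity for two variables combines it with the induction hypothesis.\<close>

lemma vandermonde_PiE:
  fixes a :: "'i \<Rightarrow> nat"
  assumes "finite I"
  shows "(\<Sum>j | j \<in> I \<rightarrow>\<^sub>E UNIV \<and> (\<Sum>i\<in>I. j i) = s. \<Prod>i\<in>I. a i choose j i) = (\<Sum>i\<in>I. a i) choose s"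
  using assms
proof (induction I arbitrary: s rule: finite_induct)
  case empty
  show ?case by (cases s) auto
next
  case (insert x F)
  let ?J = "\<lambda>s. {j :: 'i \<Rightarrow> nat. j \<in> F \<rightarrow>\<^sub>E UNIV \<and> (\<Sum>i\<in>F. j i) = s}"
  have fin: "finite (?J t)" for t
    by (rule finite_subset[OF _ finite_PiE_sum_le[OF insert(1), of t]]) auto
  have neq: "i \<noteq> x" if "i \<in> F" for i using insert(2) that by blast
  have "(\<Sum>j | j \<in> insert x F \<rightarrow>\<^sub>E UNIV \<and> (\<Sum>i\<in>insert x F. j i) = s. \<Prod>i\<in>insert x F. a i choose j i) =
      (\<Sum>(t, j)\<in>(SIGMA t:{..s}. ?J (s - t)). (a x choose t) * (\<Prod>i\<in>F. a i choose j i))"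
  \<comment> \<open>Resetting the value at \<open>x\<close> to \<open>undefined\<close> is the
    restriction of an extensional function to \<open>F\<close>.\<close>
  proof (rule sum.reindex_bij_witness[where i = "\<lambda>(t, j). j(x := t)" and j = "\<lambda>j. (j x, j(x := undefined))"])
    fix j assume j: "j \<in> {j. j \<in> insert x F \<rightarrow>\<^sub>E UNIV \<and> (\<Sum>i\<in>insert x F. j i) = s}"
    have *: "(\<Sum>i\<in>F. if i = x then undefined else j i) = (\<Sum>i\<in>F. j i)"
      using neq by (intro sum.cong) auto
    have **: "(\<Prod>i\<in>F. a i choose (if i = x then undefined else j i)) = (\<Prod>i\<in>F. a i choose j i)"
      using neq by (intro prod.cong) auto
    show "(case (j x, j(x := undefined)) of (t, j) \<Rightarrow> j(x := t)) = j" by simp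
    show "(j x, j(x := undefined)) \<in> (SIGMA t:{..s}. ?J (s - t))"
      using j insert(1,2) by (auto simp: PiE_iff extensional_def fun_upd_def *)
    show "(case (j x, j(x := undefined)) of (t, j) \<Rightarrow> (a x choose t) * (\<Prod>i\<in>F. a i choose j i)) =
        (\<Prod>i\<in>insert x F. a i choose j i)"
      using insert(1,2) by (simp add: fun_upd_def **)
  next
    fix z assume z: "z \<in> (SIGMA t:{..s}. ?J (s - t))"
    obtain t j where tj: "z = (t, j)" by (cases z)
    have *: "(\<Sum>i\<in>F. if i = x then t else j i) = (\<Sum>i\<in>F. j i)"
      using neq by (intro sum.cong) auto
    show "((case z of (t, j) \<Rightarrow> j(x := t)) x, (case z of (t, j) \<Rightarrow> j(x := t))(x := undefined)) = z"
      using z insert(2) by (auto simp: tj PiE_iff extensional_def fun_eq_iff)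
    show "(case z of (t, j) \<Rightarrow> j(x := t)) \<in>
        {j. j \<in> insert x F \<rightarrow>\<^sub>E UNIV \<and> (\<Sum>i\<in>insert x F. j i) = s}"
      using z insert(1,2) by (auto simp: tj PiE_iff extensional_def fun_upd_def *)
  qed
  also have "\<dots> = (\<Sum>t\<le>s. \<Sum>j\<in>?J (s - t). (a x choose t) * (\<Prod>i\<in>F. a i choose j i))"
    using fin by (intro sum.Sigma[symmetric]) auto
  also have "\<dots> = (\<Sum>t\<le>s. (a x choose t) * ((\<Sum>i\<in>F. a i) choose (s - t)))"
    by (simp add: insert.IH flip: sum_distrib_left)
  also have "\<dots> = (a x + (\<Sum>i\<in>F. a i)) choose s" by (rule vandermonde)
  finally show ?case using insert(1,2) by simp
qed

text \<open>Grouping by the total \<open>s\<close> and applying Vandermonde leaves a truncated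
  alternating row sum of Pascal's triangle. Its closed form is stated with \<open>gchoose\<close>
  because the upper entry is -1 when all \<open>a i\<close> vanish.\<close>

lemma alternating_sum_prod_choose:
  fixes a :: "'i \<Rightarrow> nat"
  assumes "finite I"
  shows "(\<Sum>j | j \<in> I \<rightarrow>\<^sub>E UNIV \<and> (\<Sum>i\<in>I. j i) \<le> m.
      (-1) ^ (\<Sum>i\<in>I. j i) * (\<Prod>i\<in>I. real (a i choose j i))) =
    (-1) ^ m * ((real (\<Sum>i\<in>I. a i) - 1) gchoose m)" (is "sum ?h ?S = _")
proof -
  have fin: "finite ?S" using finite_PiE_sum_le[OF assms, of m] by simp
  have "sum ?h ?S = (\<Sum>s\<le>m. \<Sum>j\<in>{j\<in>?S. (\<Sum>i\<in>I. j i) = s}. ?h j)"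
    by (rule sum.group[symmetric]) (use fin in auto)
  also have "\<dots> = (\<Sum>s\<le>m. (real (\<Sum>i\<in>I. a i) gchoose s) * (-1) ^ s)"
  proof (intro sum.cong refl)
    fix s assume "s \<in> {..m}"
    then have "{j\<in>?S. (\<Sum>i\<in>I. j i) = s} = {j. j \<in> I \<rightarrow>\<^sub>E UNIV \<and> (\<Sum>i\<in>I. j i) = s}" by auto
    then have "(\<Sum>j\<in>{j\<in>?S. (\<Sum>i\<in>I. j i) = s}. ?h j) =
        (\<Sum>j | j \<in> I \<rightarrow>\<^sub>E UNIV \<and> (\<Sum>i\<in>I. j i) = s. (-1) ^ s * real (\<Prod>i\<in>I. a i choose j i))"
      by (intro sum.cong) auto
    also have "\<dots> = (-1) ^ s * real ((\<Sum>i\<in>I. a i) choose s)"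
      unfolding vandermonde_PiE[OF assms, symmetric] by (simp add: sum_distrib_left)
    finally show "(\<Sum>j\<in>{j\<in>?S. (\<Sum>i\<in>I. j i) = s}. ?h j) = (real (\<Sum>i\<in>I. a i) gchoose s) * (-1) ^ s"
      by (simp only: binomial_gbinomial mult.commute)
  qed
  also have "\<dots> = (-1) ^ m * ((real (\<Sum>i\<in>I. a i) - 1) gchoose m)"
    by (rule gbinomial_sum_lower_neg)
  finally show ?thesis .
qed

text \<open>Trinomial revision; for \<open>k > n\<close> both sides vanish.\<close>

lemma choose_mult_of_le: "r \<le> k \<Longrightarrow> (k choose r) * (n choose k) = (n choose r) * ((n - r) choose (k - r))"
proof (cases "k \<le> n")
  case True
  assume "r \<le> k"
  then show ?thesis using choose_mult[OF _ True] by (simp add: mult.commute)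
next
  case False
  assume "r \<le> k"
  then show ?thesis using False by (cases "r \<le> n") (auto simp: binomial_eq_0)
qed

text \<open>Substituting \<open>k = r + j\<close> and applying trinomial revision in each coordinate
  pulls out the factors \<open>N i choose r i\<close>; the rest is the alternating sum for
  \<open>N i - r i\<close>.\<close>

lemma bonferroni_sum:
  fixes N r :: "'i \<Rightarrow> nat"
  assumes "finite I"
  shows "(\<Sum>k\<in>bonferroni_index I r m.
      (-1) ^ (\<Sum>i\<in>I. k i - r i) * (\<Prod>i\<in>I. real (k i choose r i)) * (\<Prod>i\<in>I. real (N i choose k i))) =
    (\<Prod>i\<in>I. real (N i choose r i)) * ((-1) ^ m * ((real (\<Sum>i\<in>I. N i - r i) - 1) gchoose m))"
proof -
  have "(\<Sum>k\<in>bonferroni_index I r m.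
      (-1) ^ (\<Sum>i\<in>I. k i - r i) * (\<Prod>i\<in>I. real (k i choose r i)) * (\<Prod>i\<in>I. real (N i choose k i))) =
    (\<Sum>j | j \<in> I \<rightarrow>\<^sub>E UNIV \<and> (\<Sum>i\<in>I. j i) \<le> m. (\<Prod>i\<in>I. real (N i choose r i)) *
      ((-1) ^ (\<Sum>i\<in>I. j i) * (\<Prod>i\<in>I. real ((N i - r i) choose j i))))"
  proof (rule sum.reindex_bij_witness[where i = "\<lambda>j. \<lambda>i\<in>I. r i + j i" and j = "\<lambda>k. \<lambda>i\<in>I. k i - r i"])
    fix k assume k: "k \<in> bonferroni_index I r m"
    show "(\<lambda>i\<in>I. r i + (\<lambda>i\<in>I. k i - r i) i) = k"
      using k by (auto simp: PiE_iff extensional_def fun_eq_iff)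
    show "(\<lambda>i\<in>I. k i - r i) \<in> {j. j \<in> I \<rightarrow>\<^sub>E UNIV \<and> (\<Sum>i\<in>I. j i) \<le> m}"
      using k by auto
    have "(\<Prod>i\<in>I. real (k i choose r i)) * (\<Prod>i\<in>I. real (N i choose k i)) =
        (\<Prod>i\<in>I. real ((k i choose r i) * (N i choose k i)))"
      by (simp add: prod.distrib)
    also have "\<dots> = (\<Prod>i\<in>I. real ((N i choose r i) * ((N i - r i) choose (k i - r i))))"
      using k by (intro prod.cong refl) (simp add: choose_mult_of_le del: of_nat_mult)
    finally show "(\<Prod>i\<in>I. real (N i choose r i)) * ((-1) ^ (\<Sum>i\<in>I. (\<lambda>i\<in>I. k i - r i) i) *
          (\<Prod>i\<in>I. real ((N i - r i) choose (\<lambda>i\<in>I. k i - r i) i))) =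
        (-1) ^ (\<Sum>i\<in>I. k i - r i) * (\<Prod>i\<in>I. real (k i choose r i)) * (\<Prod>i\<in>I. real (N i choose k i))"
      by (simp add: prod.distrib mult_ac)
  next
    fix j assume j: "j \<in> {j. j \<in> I \<rightarrow>\<^sub>E UNIV \<and> (\<Sum>i\<in>I. j i) \<le> m}"
    show "(\<lambda>i\<in>I. (\<lambda>i\<in>I. r i + j i) i - r i) = j"
      using j by (auto simp: PiE_iff extensional_def fun_eq_iff)
    show "(\<lambda>i\<in>I. r i + j i) \<in> bonferroni_index I r m"
      using j by auto
  qed
  then show ?thesis by (simp add: alternating_sum_prod_choose[OF assms] flip: sum_distrib_left)
qed

text \<open>The closed form is read off case by case: it is 0 if some \<open>N i < r i\<close>, it
  is 1 if \<open>N = r\<close> on \<open>I\<close>, and otherwise it is 0 or has the sign of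
  \<open>(-1) ^ m\<close>.\<close>

lemma bonferroni_inequalities:
  fixes N r :: "'i \<Rightarrow> nat"
  assumes "finite I"
  defines "B \<equiv> \<lambda>m. \<Sum>k\<in>bonferroni_index I r m.
    (-1) ^ (\<Sum>i\<in>I. k i - r i) * (\<Prod>i\<in>I. real (k i choose r i)) * (\<Prod>i\<in>I. real (N i choose k i))"
  shows "even m \<Longrightarrow> of_bool (\<forall>i\<in>I. N i = r i) \<le> B m"
    and "odd m \<Longrightarrow> B m \<le> of_bool (\<forall>i\<in>I. N i = r i)"
proof -
  let ?a = "\<Sum>i\<in>I. N i - r i"
  let ?c = "\<Prod>i\<in>I. real (N i choose r i)"
  have B: "B m = ?c * ((-1) ^ m * ((real ?a - 1) gchoose m))"
    unfolding B_def by (rule bonferroni_sum[OF assms(1)])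
  have c: "?c \<ge> 0" by (intro prod_nonneg) auto
  \<comment> \<open>The first and third cases may overlap; together the three are
    exhaustive.\<close>
  consider (lt) i where "i \<in> I" "N i < r i" | (eq) "\<forall>i\<in>I. N i = r i"
    | (gt) i where "i \<in> I" "N i > r i"
    by (meson linorder_neqE_nat)
  then have "(even m \<longrightarrow> of_bool (\<forall>i\<in>I. N i = r i) \<le> B m) \<and> (odd m \<longrightarrow> B m \<le> of_bool (\<forall>i\<in>I. N i = r i))"
  proof cases
    case lt
    then have "?c = 0" using assms(1) by (auto simp: prod_zero_iff binomial_eq_0)
    moreover have "(\<forall>i\<in>I. N i = r i) = False" using lt by force
    ultimately show ?thesis by (simp only: B) simp
  next
    case eq
    then have "?c = 1" "?a = 0" by auto
    \<comment> \<open>With upper entry -1 the coefficient is itself a sign, which cancels the sign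
      in front.\<close>
    moreover have "(-1 :: real) gchoose m = (-1) ^ m"
      using gbinomial_minus[of 1 m] by (simp flip: binomial_gbinomial)
    then have "(-1) ^ m * ((-1 :: real) gchoose m) = 1"
      by (simp flip: power_mult_distrib)
    ultimately have "B m = 1" by (simp add: B)
    then show ?thesis using eq by simp
  next
    case gt
    then have "?a \<noteq> 0" using assms(1) by (simp add: sum_eq_0_iff) (use gt in force)
    \<comment> \<open>As \<open>?a\<close> is at least 1, the upper entry is a natural number and
      the coefficient is nonnegative.\<close>
    then have "real ?a - 1 = real (?a - 1)" by (simp add: of_nat_diff)
    then have "((real ?a - 1) gchoose m) \<ge> 0" by (simp only: binomial_gbinomial[symmetric] of_nat_0_le_iff)
    moreover have "\<not> (\<forall>i\<in>I. N i = r i)" using gt by force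
    ultimately show ?thesis using c by (auto simp: B mult_nonneg_nonneg)
  qed
  then show "even m \<Longrightarrow> of_bool (\<forall>i\<in>I. N i = r i) \<le> B m"
    and "odd m \<Longrightarrow> B m \<le> of_bool (\<forall>i\<in>I. N i = r i)" by auto
qed

text \<open>For fixed \<open>m\<close> the truncated sum \<open>G m\<close> converges along
  \<open>F\<close> to the partial sum \<open>U m\<close>, and it bounds the point probability from a
  side given by the parity of \<open>m\<close>. Choosing \<open>m\<close> first and then passing to
  the limit along \<open>F\<close> avoids any exchange of limits.\<close>

lemma joint_law_tendsto_of_binomial_moments:
  fixes w :: "'n \<Rightarrow> 'a \<Rightarrow> real" and N :: "'n \<Rightarrow> 'a \<Rightarrow> 'i \<Rightarrow> nat"
  assumes I: "finite I" and w: "\<And>n x. w n x \<ge> 0"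
    and moments: "\<And>k. k \<in> I \<rightarrow>\<^sub>E UNIV \<Longrightarrow>
      ((\<lambda>n. \<Sum>x\<in>T n. w n x * (\<Prod>i\<in>I. real (N n x i choose k i))) \<longlongrightarrow> S k) F"
    and series: "(\<lambda>m. \<Sum>k\<in>bonferroni_index I r m.
      (-1) ^ (\<Sum>i\<in>I. k i - r i) * (\<Prod>i\<in>I. real (k i choose r i)) * S k) \<longlonglongrightarrow> L"
  shows "((\<lambda>n. \<Sum>x\<in>T n. w n x * of_bool (\<forall>i\<in>I. N n x i = r i)) \<longlongrightarrow> L) F"
proof -
  let ?c = "\<lambda>k. (-1) ^ (\<Sum>i\<in>I. k i - r i) * (\<Prod>i\<in>I. real (k i choose r i))"
  let ?p = "\<lambda>n. \<Sum>x\<in>T n. w n x * of_bool (\<forall>i\<in>I. N n x i = r i)"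
  define U where "U m = (\<Sum>k\<in>bonferroni_index I r m. ?c k * S k)" for m
  define G where "G m n = (\<Sum>k\<in>bonferroni_index I r m.
    ?c k * (\<Sum>x\<in>T n. w n x * (\<Prod>i\<in>I. real (N n x i choose k i))))" for m n
  have G: "(G m \<longlongrightarrow> U m) F" for m
    unfolding G_def U_def by (intro tendsto_sum tendsto_mult_left moments) auto
  \<comment> \<open>By linearity \<open>G m n\<close> is the weighted sum of the pointwise
    Bonferroni expressions.\<close>
  have G_eq: "G m n = (\<Sum>x\<in>T n. w n x * (\<Sum>k\<in>bonferroni_index I r m.
      ?c k * (\<Prod>i\<in>I. real (N n x i choose k i))))" for m n
    unfolding G_def sum_distrib_left by (subst sum.swap) (simp add: mult_ac)
  have upper: "?p n \<le> G m n" if "even m" for m n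
    unfolding G_eq using bonferroni_inequalities(1)[OF I that]
    by (intro sum_mono mult_left_mono w)
  have lower: "G m n \<le> ?p n" if "odd m" for m n
    unfolding G_eq using bonferroni_inequalities(2)[OF I that]
    by (intro sum_mono mult_left_mono w)
  have U: "U \<longlonglongrightarrow> L" using series unfolding U_def .
  show ?thesis
  proof (rule order_tendstoI)
    fix a assume "a < L"
    then obtain M where "\<forall>m\<ge>M. a < U m"
      using order_tendstoD(1)[OF U] by (auto simp: eventually_sequentially)
    \<comment> \<open>An odd index beyond \<open>M\<close> gives a lower bound; below, an even one
      gives an upper bound.\<close>
    then have "a < U (2 * M + 1)" by simp
    then have "eventually (\<lambda>n. a < G (2 * M + 1) n) F" by (rule order_tendstoD(1)[OF G])
    then show "eventually (\<lambda>n. a < ?p n) F"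
      by (rule eventually_mono) (rule less_le_trans[OF _ lower], auto)
  next
    fix a assume "L < a"
    then obtain M where "\<forall>m\<ge>M. U m < a"
      using order_tendstoD(2)[OF U] by (auto simp: eventually_sequentially)
    then have "U (2 * M) < a" by simp
    then have "eventually (\<lambda>n. G (2 * M) n < a) F" by (rule order_tendstoD(2)[OF G])
    then show "eventually (\<lambda>n. ?p n < a) F"
      by (rule eventually_mono) (rule le_less_trans[OF upper], auto)
  qed
qed

section \<open>Weak convergence on countable discrete spaces\<close>

text \<open>Singletons are boxes, hence measurable, and every subset of the countable product is a
  countable union of them.\<close>

lemma sets_PiM_count_space_countable:
  fixes I :: "'i set"
  assumes "finite I"
  shows "sets (PiM I (\<lambda>_. count_space (UNIV :: 'b::countable set))) = Pow (I \<rightarrow>\<^sub>E UNIV)"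
    (is "sets ?M = _")
proof
  show "sets ?M \<subseteq> Pow (I \<rightarrow>\<^sub>E UNIV)"
    using sets.sets_into_space[of _ ?M] by (auto simp: space_PiM)
  have single: "{x} \<in> sets ?M" if "x \<in> I \<rightarrow>\<^sub>E UNIV" for x
  proof -
    have "Pi\<^sub>E I (\<lambda>i. {x i}) \<in> sets ?M" using assms by (intro sets_PiM_I_finite) auto
    moreover have "Pi\<^sub>E I (\<lambda>i. {x i}) = {x}" using that by (intro PiE_singleton) (simp add: PiE_iff)
    ultimately show ?thesis by simp
  qed
  have "countable (I \<rightarrow>\<^sub>E (UNIV :: 'b set))" using assms by (intro countable_PiE) auto
  then show "Pow (I \<rightarrow>\<^sub>E UNIV) \<subseteq> sets ?M"
    by (auto intro!: sets.countable single dest: countable_subset)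
qed

lemma measure_PiM_PiE:
  assumes "finite I" "\<And>i. i \<in> I \<Longrightarrow> prob_space (M i)" "\<And>i. i \<in> I \<Longrightarrow> E i \<in> sets (M i)"
  shows "measure (PiM I M) (Pi\<^sub>E I E) = (\<Prod>i\<in>I. measure (M i) (E i))"
proof -
  have "emeasure (PiM I M) (Pi\<^sub>E I E) = emeasure (PiM I M) (prod_emb I M I (Pi\<^sub>E I E))"
    using sets.sets_into_space[OF assms(3)] by (subst prod_emb_PiE_same_index) auto
  also have "\<dots> = (\<Prod>i\<in>I. emeasure (M i) (E i))"
    by (rule emeasure_PiM_emb) (use assms in auto)
  also have "\<dots> = (\<Prod>i\<in>I. ennreal (measure (M i) (E i)))"
    using assms(2) by (intro prod.cong refl finite_measure.emeasure_eq_measure)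
      (simp add: prob_space.finite_measure)
  also have "\<dots> = ennreal (\<Prod>i\<in>I. measure (M i) (E i))"
    by (intro prod_ennreal) simp
  finally show ?thesis by (simp add: measure_def prod_nonneg)
qed

section \<open>Integrals and point masses on a countable set\<close>

lemma space_eq_of_sets_Pow: "sets M = Pow C \<Longrightarrow> space M = C"
  using sets_eq_imp_space_eq[of M "count_space C"] by simp

text \<open>Subtracting from \<open>f\<close> its restriction to \<open>K\<close> leaves a function
  that vanishes on \<open>K\<close> and is bounded by \<open>B\<close> elsewhere.\<close>

lemma integral_minus_finite_sum_bound:
  fixes f :: "'a \<Rightarrow> real"
  assumes M: "prob_space M" "sets M = Pow C" and K: "finite K" "K \<subseteq> C"
    and f: "\<And>x. x \<in> C \<Longrightarrow> \<bar>f x\<bar> \<le> B"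
  shows "\<bar>(\<integral>x. f x \<partial>M) - (\<Sum>x\<in>K. f x * measure M {x})\<bar> \<le> B * (1 - measure M K)"
proof -
  interpret prob_space M by fact
  have space: "space M = C" using M(2) by (rule space_eq_of_sets_Pow)
  have meas: "g \<in> borel_measurable M" for g :: "'a \<Rightarrow> real"
    using M(2) space by (auto simp: measurable_def)
  have int: "integrable M f"
    using f meas by (intro integrable_const_bound[of _ B]) (auto simp: space)
  have ints: "integrable M (\<lambda>x. f y * indicator {y} x)" if "y \<in> K" for y
    using K that M(2)
    by (intro integrable_mult_right integrable_real_indicator) (auto simp flip: less_top)
  have "(\<Sum>x\<in>K. f x * measure M {x}) = (\<Sum>y\<in>K. \<integral>x. f y * indicator {y} x \<partial>M)"
    using K M(2) space by (intro sum.cong) (auto simp: Int_absorb2)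
  also have "\<dots> = (\<integral>x. (\<Sum>y\<in>K. f y * indicator {y} x) \<partial>M)"
    using ints by (intro Bochner_Integration.integral_sum[symmetric]) auto
  finally have "(\<integral>x. f x \<partial>M) - (\<Sum>x\<in>K. f x * measure M {x}) =
      (\<integral>x. f x - (\<Sum>y\<in>K. f y * indicator {y} x) \<partial>M)"
    using int ints by (simp add: Bochner_Integration.integral_diff)
  also have "\<bar>\<dots>\<bar> \<le> (\<integral>x. \<bar>f x - (\<Sum>y\<in>K. f y * indicator {y} x)\<bar> \<partial>M)"
    by (rule integral_abs_bound)
  also have "\<dots> \<le> (\<integral>x. B * indicator (C - K) x \<partial>M)"
  proof (rule integral_mono)
    show "integrable M (\<lambda>x. \<bar>f x - (\<Sum>y\<in>K. f y * indicator {y} x)\<bar>)"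
      using int ints by (intro integrable_abs Bochner_Integration.integrable_diff
          Bochner_Integration.integrable_sum) auto
    show "integrable M (\<lambda>x. B * indicator (C - K) x)"
      using M(2)
      by (intro integrable_mult_right integrable_real_indicator) (auto simp flip: less_top)
    fix x assume "x \<in> space M"
    then have x: "x \<in> C" by (simp add: space)
    have "(\<Sum>y\<in>K. f y * indicator {y} x) = (\<Sum>y\<in>K. if x = y then f y else 0)"
      by (intro sum.cong) auto
    then show "\<bar>f x - (\<Sum>y\<in>K. f y * indicator {y} x)\<bar> \<le> B * indicator (C - K) x"
      using x f[OF x] K(1) by (simp add: indicator_def)
  qed
  also have "\<dots> = B * measure M (C - K)" using M(2) space by (simp add: Int_absorb2)
  also have "measure M (C - K) = 1 - measure M K"
    using prob_compl[of K] K M(2) space by auto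
  finally show ?thesis .
qed

text \<open>The initial segments of an enumeration increase to \<open>C\<close>, so continuity from
  below applies.\<close>

lemma exists_finite_set_almost_full:
  assumes "prob_space L" "sets L = Pow C" "countable C" "e > 0"
  shows "\<exists>K. finite K \<and> K \<subseteq> C \<and> 1 - measure L K < e"
proof -
  interpret prob_space L by fact
  have space: "space L = C" using assms(2) by (rule space_eq_of_sets_Pow)
  have ne: "C \<noteq> {}" using not_empty space by simp
  define K where "K n = from_nat_into C ` {..n}" for n :: nat
  have K: "finite (K n)" "K n \<subseteq> C" for n
    using from_nat_into[OF ne] by (auto simp: K_def)
  have "(\<Union>n. K n) = C"
    using from_nat_into_surj[OF assms(3)] K by (fastforce simp: K_def)
  moreover have "incseq K" by (auto simp: K_def incseq_def)
  ultimately have "(\<lambda>n. measure L (K n)) \<longlonglongrightarrow> measure L C"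
    using finite_Lim_measure_incseq[of K] K assms(2) by auto
  moreover have "measure L C = 1" using prob_space space by simp
  ultimately have "eventually (\<lambda>n. measure L (K n) > 1 - e) sequentially"
    using order_tendstoD(1)[of "\<lambda>n. measure L (K n)" 1 sequentially "1 - e"] assms(4) by simp
  then obtain n where "measure L (K n) > 1 - e" by (auto simp: eventually_sequentially)
  then show ?thesis using K by (intro exI[of _ "K n"]) auto
qed

text \<open>Tightness comes from the limit \<open>L\<close>: on a finite set \<open>K\<close> of
  almost full \<open>L\<close>-mass the point masses converge, so \<open>M n\<close> too has little
  mass outside \<open>K\<close> eventually.\<close>

lemma integral_tendsto_of_singletons:
  fixes f :: "'a \<Rightarrow> real"
  assumes C: "countable C"
    and M: "eventually (\<lambda>n. prob_space (M n) \<and> sets (M n) = Pow C) F"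
    and L: "prob_space L" "sets L = Pow C"
    and lim: "\<And>x. x \<in> C \<Longrightarrow> ((\<lambda>n. measure (M n) {x}) \<longlongrightarrow> measure L {x}) F"
    and f: "bounded (f ` C)"
  shows "((\<lambda>n. \<integral>x. f x \<partial>M n) \<longlongrightarrow> (\<integral>x. f x \<partial>L)) F"
proof (rule tendstoI)
  fix e :: real assume e: "e > 0"
  obtain B where B: "B > 0" "\<And>x. x \<in> C \<Longrightarrow> \<bar>f x\<bar> \<le> B"
    using f by (auto simp: bounded_pos)
  \<comment> \<open>With this constant the two tails and the finite sum each contribute less than
    \<open>e / 4\<close> in the end.\<close>
  obtain K where K: "finite K" "K \<subseteq> C" "1 - measure L K < e / (4 * B)"
    using exists_finite_set_almost_full[OF L C, of "e / (4 * B)"] e B(1) by auto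
  have sing: "measure N K = (\<Sum>x\<in>K. measure N {x})" if "prob_space N" "sets N = Pow C" for N
  proof -
    interpret prob_space N by fact
    show ?thesis using K that by (intro finite_measure_eq_sum_singleton) auto
  qed
  have limK: "((\<lambda>n. \<Sum>x\<in>K. measure (M n) {x}) \<longlongrightarrow> measure L K) F"
    unfolding sing[OF L] using K(2) by (intro tendsto_sum lim) auto
  have "((\<lambda>n. B * (1 - (\<Sum>x\<in>K. measure (M n) {x}))) \<longlongrightarrow> B * (1 - measure L K)) F"
    by (intro tendsto_intros limK)
  moreover have BL: "B * (1 - measure L K) < e / 4" using K(3) B(1) by (simp add: field_simps)
  ultimately have 1: "eventually (\<lambda>n. B * (1 - (\<Sum>x\<in>K. measure (M n) {x})) < e / 4) F"
    by (rule order_tendstoD(2))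
  have "((\<lambda>n. \<Sum>x\<in>K. f x * measure (M n) {x}) \<longlongrightarrow> (\<Sum>x\<in>K. f x * measure L {x})) F"
    using K(2) by (intro tendsto_sum tendsto_mult_left lim) auto
  then have 2: "eventually (\<lambda>n. dist (\<Sum>x\<in>K. f x * measure (M n) {x}) (\<Sum>x\<in>K. f x * measure L {x}) < e / 4) F"
    using e by (intro tendstoD) auto
  show "eventually (\<lambda>n. dist (\<integral>x. f x \<partial>M n) (\<integral>x. f x \<partial>L) < e) F"
    using M 1 2
  proof eventually_elim
    case (elim n)
    then have "\<bar>(\<integral>x. f x \<partial>M n) - (\<Sum>x\<in>K. f x * measure (M n) {x})\<bar> \<le> B * (1 - measure (M n) K)"
      using K B(2) by (intro integral_minus_finite_sum_bound) auto
    moreover have "\<bar>(\<integral>x. f x \<partial>L) - (\<Sum>x\<in>K. f x * measure L {x})\<bar> \<le> B * (1 - measure L K)"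
      using K L B(2) by (intro integral_minus_finite_sum_bound) auto
    moreover have "B * (1 - measure (M n) K) < e / 4" using elim sing[of "M n"] by simp
    ultimately show ?case using elim(3) BL e unfolding dist_real_def by linarith
  qed
qed

section \<open>Convergence of the cycle counts\<close>

theorem theorem1p1:
  fixes A :: "nat set"
    and q :: nat
    and l :: "nat \<Rightarrow> nat"
    and \<mu> :: "nat \<Rightarrow> nat measure"
    and P :: "nat \<Rightarrow> (nat \<Rightarrow> nat) measure"
    and S :: "(nat \<Rightarrow> nat) \<Rightarrow> real"
    and \<Omega> :: "nat \<Rightarrow> 'w measure"
    and X :: "nat \<Rightarrow> 'w \<Rightarrow> nat \<Rightarrow> nat"
  assumes A: "infinite A" "\<forall>n\<in>A. n \<ge> 1"
    and q: "q \<ge> 1"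
    and l: "\<forall>i\<in>{1..q}. l i \<ge> 1" "strict_mono_on {1..q} l"
    and mu: "\<forall>i\<in>{1..q}. prob_space (\<mu> i) \<and> sets (\<mu> i) = Pow UNIV"
    and P: "\<forall>n\<in>A. prob_space (P n) \<and> space (P n) = Sym n \<and> sets (P n) = Pow (Sym n)"
    and P_inv: "\<forall>n\<in>A. conj_invariant n (P n)"
    and S_lim: "\<forall>p\<ge>1. \<forall>k\<in>nat_vecs q. (\<Sum>i=1..q. k i * l i) = p \<longrightarrow>
      (\<forall>\<sigma>\<in>Sym p. (\<forall>i\<in>{1..q}. num_cycles p (l i) \<sigma> = k i) \<longrightarrow>
        ((\<lambda>n. real n ^ p / (\<Prod>i=1..q. real (l i) ^ k i * fact (k i))
               * measure (P n) {\<tau>\<in>Sym n. \<forall>i\<in>{1..p}. \<tau> i = \<sigma> i}) \<longlongrightarrow> S k) (at_top_in A))"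
    and S_0: "S (\<lambda>i\<in>{1..q}. 0) = 1"
    and S_sum: "\<forall>r\<in>nat_vecs q.
      (\<lambda>m. \<Sum>k | k \<in> nat_vecs q \<and> (\<forall>i\<in>{1..q}. k i \<ge> r i) \<and> (\<Sum>i=1..q. k i - r i) \<le> m.
              (-1) ^ (\<Sum>i=1..q. k i - r i) * (\<Prod>i=1..q. real (k i choose r i)) * S k)
        \<longlonglongrightarrow> (\<Prod>i=1..q. measure (\<mu> i) {r i})"
    and X: "\<forall>n\<in>A. prob_space (\<Omega> n) \<and> X n \<in> measurable (\<Omega> n) (P n) \<and> distr (\<Omega> n) (P n) (X n) = P n"
  shows "weakly_converges (product_topology (\<lambda>_. discrete_topology UNIV) {1..q})
           (\<lambda>n. distr (\<Omega> n) (PiM {1..q} (\<lambda>_. count_space UNIV))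
                  (\<lambda>\<omega>. \<lambda>i\<in>{1..q}. num_cycles n (l i) (X n \<omega>)))
           (PiM {1..q} \<mu>) (at_top_in A)"
proof -
  let ?F = "at_top_in A"
  let ?Q = "PiM {1..q} (\<lambda>_. count_space (UNIV :: nat set))"
  define g where "g n \<tau> = (\<lambda>i\<in>{1..q}. num_cycles n (l i) \<tau>)" for n \<tau>
  have Q: "sets ?Q = Pow (nat_vecs q)" by (rule sets_PiM_count_space_countable) simp
  have P': "prob_space (P n) \<and> sets (P n) = Pow (Sym n)" if "n \<in> A" for n
    using P that by blast
  have g: "g n \<in> measurable (P n) ?Q" if "n \<in> A" for n
    using P[rule_format, OF that] by (auto simp: measurable_def g_def Q space_PiM)
  \<comment> \<open>The law of the counts is the image of \<open>P n\<close> under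
    \<open>g n\<close>, so all computations take place on \<open>Sym n\<close>.\<close>
  have law: "distr (\<Omega> n) ?Q (\<lambda>\<omega>. g n (X n \<omega>)) = distr (P n) ?Q (g n)" if "n \<in> A" for n
    using distr_distr[OF g[OF that], of "X n" "\<Omega> n"] X[rule_format, OF that] by (simp add: comp_def)

  have moments: "((\<lambda>n. \<Sum>\<tau>\<in>Sym n. measure (P n) {\<tau>} * (\<Prod>i=1..q. real (num_cycles n (l i) \<tau> choose k i)))
      \<longlongrightarrow> S k) ?F" if k: "k \<in> nat_vecs q" for k
  \<comment> \<open>The limit hypothesis starts at \<open>p = 1\<close>. For \<open>p = 0\<close>
    all \<open>k i\<close> vanish, the moment is the total mass, and \<open>S_0\<close> supplies the
    limit 1.\<close>
  proof (cases "(\<Sum>i=1..q. k i * l i) = 0")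
    case True
    then have k0: "k i = 0" if "i \<in> {1..q}" for i using l(1) that by fastforce
    then have "k = (\<lambda>i\<in>{1..q}. 0)" using k by (auto simp: PiE_iff extensional_def)
    then have "S k = 1" using S_0 by simp
    moreover have "(\<Sum>\<tau>\<in>Sym n. measure (P n) {\<tau>} * (\<Prod>i=1..q. real (num_cycles n (l i) \<tau> choose k i))) = 1"
      if "n \<in> A" for n
    proof -
      have "(\<Sum>\<tau>\<in>Sym n. measure (P n) {\<tau>}) = measure (P n) (Sym n)"
        using P'[OF that] finite_Sym by (intro measure_eq_sum_singletons[symmetric]) auto
      also have "\<dots> = 1" using P[rule_format, OF that] prob_space.prob_space by metis
      finally show ?thesis using k0 by simp
    qed
    ultimately show ?thesis
      by (intro tendsto_eventually eventually_at_top_inI) auto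
  next
    case False
    show ?thesis
    proof (rule binomial_moments_tendsto[OF _ _ l(1)])
      show "inj_on l {1..q}" using l(2) by (rule strict_mono_on_imp_inj_on)
      have p: "(\<Sum>i=1..q. k i * l i) \<ge> 1" using False by linarith
      fix \<sigma> assume "\<sigma> \<in> Sym (\<Sum>i=1..q. k i * l i)"
        "\<forall>i\<in>{1..q}. num_cycles (\<Sum>i=1..q. k i * l i) (l i) \<sigma> = k i"
      then show "((\<lambda>n. real n ^ (\<Sum>i=1..q. k i * l i) / (\<Prod>i=1..q. real (l i) ^ k i * fact (k i))
          * measure (P n) {\<tau>\<in>Sym n. \<forall>i\<in>{1..\<Sum>i=1..q. k i * l i}. \<tau> i = \<sigma> i}) \<longlongrightarrow> S k) ?F"
        using S_lim[THEN spec, THEN mp, OF p, THEN bspec, OF k] by blast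
    qed (use P' P_inv in auto)
  qed

  have point: "((\<lambda>n. measure (distr (\<Omega> n) ?Q (\<lambda>\<omega>. g n (X n \<omega>))) {r}) \<longlongrightarrow> measure (PiM {1..q} \<mu>) {r}) ?F"
    if r: "r \<in> nat_vecs q" for r
  proof -
    have "measure (PiM {1..q} \<mu>) {r} = (\<Prod>i=1..q. measure (\<mu> i) {r i})"
    proof -
      \<comment> \<open>A single vector is a box, so its mass is a product of point masses.\<close>
      have "{r} = Pi\<^sub>E {1..q} (\<lambda>i. {r i})"
        using r by (intro PiE_singleton[symmetric]) (simp add: PiE_iff)
      then show ?thesis using mu by (simp only:) (intro measure_PiM_PiE, auto)
    qed
    moreover have "((\<lambda>n. \<Sum>\<tau>\<in>Sym n. measure (P n) {\<tau>} * of_bool (\<forall>i\<in>{1..q}. num_cycles n (l i) \<tau> = r i))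
        \<longlongrightarrow> (\<Prod>i=1..q. measure (\<mu> i) {r i})) ?F"
      by (rule joint_law_tendsto_of_binomial_moments[OF _ _ moments S_sum[rule_format, OF r]]) auto
    ultimately have "((\<lambda>n. \<Sum>\<tau>\<in>Sym n. measure (P n) {\<tau>} * of_bool (\<forall>i\<in>{1..q}. num_cycles n (l i) \<tau> = r i))
        \<longlongrightarrow> measure (PiM {1..q} \<mu>) {r}) ?F" by simp
    then show ?thesis
    proof (rule Lim_transform_eventually, intro eventually_at_top_inI)
      fix n assume n: "n \<in> A"
      \<comment> \<open>Both vectors are extensional, so equality is agreement on
        \<open>{1..q}\<close>.\<close>
      have eq: "g n -` {r} \<inter> Sym n = {\<tau>\<in>Sym n. \<forall>i\<in>{1..q}. num_cycles n (l i) \<tau> = r i}"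
        using r by (auto simp: g_def PiE_iff extensional_def fun_eq_iff)
      have "measure (distr (\<Omega> n) ?Q (\<lambda>\<omega>. g n (X n \<omega>))) {r} = measure (P n) (g n -` {r} \<inter> Sym n)"
        unfolding law[OF n] using P[rule_format, OF n] r
        by (subst measure_distr[OF g[OF n]]) (simp_all only: Q, auto)
      also have "\<dots> = (\<Sum>\<tau>\<in>{\<tau>\<in>Sym n. \<forall>i\<in>{1..q}. num_cycles n (l i) \<tau> = r i}. measure (P n) {\<tau>})"
        unfolding eq using P'[OF n] finite_Sym[of n]
        by (intro measure_eq_sum_singletons) auto
      also have "\<dots> = (\<Sum>\<tau>\<in>Sym n. measure (P n) {\<tau>} * of_bool (\<forall>i\<in>{1..q}. num_cycles n (l i) \<tau> = r i))"
        using finite_Sym[of n] by (intro sum.mono_neutral_cong_left) auto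
      finally show "(\<Sum>\<tau>\<in>Sym n. measure (P n) {\<tau>} * of_bool (\<forall>i\<in>{1..q}. num_cycles n (l i) \<tau> = r i)) =
          measure (distr (\<Omega> n) ?Q (\<lambda>\<omega>. g n (X n \<omega>))) {r}" by simp
    qed
  qed

  \<comment> \<open>Convergence for all bounded functions on \<open>nat_vecs q\<close> covers the
    bounded continuous ones.\<close>
  have "((\<lambda>n. \<integral>x. f x \<partial>distr (\<Omega> n) ?Q (\<lambda>\<omega>. g n (X n \<omega>))) \<longlongrightarrow> (\<integral>x. f x \<partial>PiM {1..q} \<mu>)) ?F"
    if "bounded (f ` nat_vecs q)" for f :: "(nat \<Rightarrow> nat) \<Rightarrow> real"
  proof (rule integral_tendsto_of_singletons[OF _ _ _ _ point that])
    show "countable (nat_vecs q)" by (intro countable_PiE) auto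
    show "eventually (\<lambda>n. prob_space (distr (\<Omega> n) ?Q (\<lambda>\<omega>. g n (X n \<omega>))) \<and>
        sets (distr (\<Omega> n) ?Q (\<lambda>\<omega>. g n (X n \<omega>))) = Pow (nat_vecs q)) ?F"
    proof (rule eventually_at_top_inI)
      fix n assume n: "n \<in> A"
      have "prob_space (distr (P n) ?Q (g n))"
        by (rule prob_space.prob_space_distr[OF _ g[OF n]]) (use P' n in blast)
      then show "prob_space (distr (\<Omega> n) ?Q (\<lambda>\<omega>. g n (X n \<omega>))) \<and>
          sets (distr (\<Omega> n) ?Q (\<lambda>\<omega>. g n (X n \<omega>))) = Pow (nat_vecs q)"
        unfolding law[OF n] sets_distr Q by simp
    qed
    show "prob_space (PiM {1..q} \<mu>)" using mu by (intro prob_space_PiM) auto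
    \<comment> \<open>Each \<open>\<mu> i\<close> has the same measurable sets as the counting
      measure, so both products have the same \<sigma>-algebra.\<close>
    have "sets (PiM {1..q} \<mu>) = sets ?Q" using mu by (intro sets_PiM_cong) auto
    then show "sets (PiM {1..q} \<mu>) = Pow (nat_vecs q)" using Q by simp
  qed
  then show ?thesis by (simp add: weakly_converges_def g_def)
qed

end
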